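(* Let $K\ge1$, let $f=h+\overline{g}\in\mathcal{S}_H^{0}(K,\Omega)$ and let $\omega=g'/h'$. Then the following statements are true. (a) If $$\limsup_{|z|\to1^-}\left\{(1-|z|^2)\,\mathrm{Re}\big(zP_f(z)\big)\right\}<1+k,$$ where $k=\frac{K-1}{K+1}\le\frac12$, then $\Omega$ is a radial John disk (with respect to $f$). (b) If $h$ is univalent in $\mathbb{D}$ and $$\limsup_{|z|\to1^-}\left\{(1-|z|^2)\left|P_f(z)+\frac{\omega'(z)\overline{\omega(z)}}{1-|\omega(z)|^2}\right|\right\}<2,$$ then $\Omega$ is a radial John disk (with respect to $f$).
   Context: $\mathbb{D}$ is the open unit disk in $\mathbb{C}$. For a domain $G\subset\mathbb{C}$ and $w\in G$, $d_G(w)$ is the Euclidean distance from $w$ to $\partial G$. $\mathcal{S}_H$ is the family of sense-preserving harmonic univalent mappings $f=h+\overline{g}$ of $\mathbb{D}$ with $h,g$ analytic in $\mathbb{D}$ and $h(0)=g(0)=h'(0)-1=0$; sense-preserving means $J_f=|h'|^2-|g'|^2>0$ in $\mathbb{D}$ (equivalently $h'\ne0$ and $|\omega|<1$ in $\mathbb{D}$, where $\omega=g'/h'$ is the dilatation). $\mathcal{S}_H^0=\{f\in\mathcal{S}_H: g'(0)=0\}$. For $K\ge1$, a sense-preserving homeomorphism $f$ of a domain, of Sobolev class $W^{1,2}_{loc}$, is $K$-quasiconformal if $\|D_f(z)\|^2\le K|\det D_f(z)|$, i.e. $\|D_f(z)\|\le K\,l(D_f(z))$, where $\|D_f\|=|f_z|+|f_{\bar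 z}|$ and $l(D_f)=\big||f_z|-|f_{\bar z}|\big|$. $\mathcal{S}_H^0(K,\Omega)$ is the set of $f\in\mathcal{S}_H^0$ that are $K$-quasiconformal and map $\mathbb{D}$ onto the domain $\Omega\subset\mathbb{C}$. The Pre-Schwarzian derivative of a sense-preserving harmonic mapping $f=h+\overline{g}$ is $$P_f=(\log J_f)_z=\frac{h''\overline{h'}-g''\overline{g'}}{|h'|^2-|g'|^2}=\frac{h''}{h'}-\frac{\omega'\overline{\omega}}{1-|\omega|^2}.$$ Radial John disk: let $f$ be a complex-valued univalent mapping of $\mathbb{D}$ and let $G=f(\mathbb{D})$ be a bounded simply connected domain. $G$ is a radial $c$-John disk ($c\ge1$) if for every $z\in\mathbb{D}$ the arc $\gamma=f([0,z])$, joining $w_1=f(z)$ to the John center $w_0=f(0)$, is rectifiable and satisfies: for every $w$ on $\gamma$, the Euclidean length of the subarc $\gamma[w_1,w]$ of $\gamma$ between $w_1$ and $w$ is at most $c\,d_G(w)$. $G$ is a radial John disk if it is a radial $c$-John disk for some $c\ge1$. *)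

theory Defs
  imports "HOL-Complex_Analysis.Complex_Analysis"
begin

abbreviation unit_disk :: "complex set" ("\<D>") where
  "\<D> \<equiv> ball 0 1"


subsection \<open>Wirtinger derivatives and the Jacobian\<close>

definition wirtinger :: "(complex \<Rightarrow> complex) \<Rightarrow> complex \<Rightarrow> complex" where
  "wirtinger f z =
     (frechet_derivative f (at z) 1 - \<i> * frechet_derivative f (at z) \<i>) / 2"

definition wirtinger_bar :: "(complex \<Rightarrow> complex) \<Rightarrow> complex \<Rightarrow> complex" where
  "wirtinger_bar f z =
     (frechet_derivative f (at z) 1 + \<i> * frechet_derivative f (at z) \<i>) / 2"

definition jacobian :: "(complex \<Rightarrow> complex) \<Rightarrow> complex \<Rightarrow> real" where
  "jacobian f z = (cmod (wirtinger f z))\<^sup>2 - (cmod (wirtinger_bar f z))\<^sup>2"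

definition diff_norm :: "(complex \<Rightarrow> complex) \<Rightarrow> complex \<Rightarrow> real" where
  "diff_norm f z = cmod (wirtinger f z) + cmod (wirtinger_bar f z)"


subsection \<open>Quasiconformal mappings\<close>

definition locally_square_integrable :: "complex set \<Rightarrow> (complex \<Rightarrow> complex) \<Rightarrow> bool" where
  "locally_square_integrable G u \<longleftrightarrow>
     u \<in> borel_measurable (lebesgue_on G) \<and>
     (\<forall>C. compact C \<and> C \<subseteq> G \<longrightarrow> set_integrable lebesgue C (\<lambda>z. (cmod (u z))\<^sup>2))"

text \<open>For first-order weak derivatives, test functions of class $C^1$ and of class
  $C^\infty$ determine the same notion.\<close>

definition test_function :: "complex set \<Rightarrow> (complex \<Rightarrow> real) \<Rightarrow> bool" where
  "test_function G \<phi> \<longleftrightarrow>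
     (\<forall>z. \<phi> differentiable (at z)) \<and>
     (\<forall>e. continuous_on UNIV (\<lambda>z. frechet_derivative \<phi> (at z) e)) \<and>
     compact (closure {z. \<phi> z \<noteq> 0}) \<and> closure {z. \<phi> z \<noteq> 0} \<subseteq> G"

definition weak_partial ::
    "complex set \<Rightarrow> (complex \<Rightarrow> complex) \<Rightarrow> complex \<Rightarrow> (complex \<Rightarrow> complex) \<Rightarrow> bool" where
  "weak_partial G f e u \<longleftrightarrow>
     (\<forall>\<phi>. test_function G \<phi> \<longrightarrow>
        (LINT z:G|lebesgue. of_real (frechet_derivative \<phi> (at z) e) * f z) =
        - (LINT z:G|lebesgue. of_real (\<phi> z) * u z))"

definition W12_loc :: "complex set \<Rightarrow> (complex \<Rightarrow> complex) \<Rightarrow> bool" where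
  "W12_loc G f \<longleftrightarrow>
     locally_square_integrable G f \<and>
     (\<exists>u. locally_square_integrable G u \<and> weak_partial G f 1 u) \<and>
     (\<exists>v. locally_square_integrable G v \<and> weak_partial G f \<i> v)"

text \<open>A plane homeomorphism preserves orientation when its local degree is one.\<close>

definition sense_preserving_homeo :: "complex set \<Rightarrow> (complex \<Rightarrow> complex) \<Rightarrow> bool" where
  "sense_preserving_homeo G f \<longleftrightarrow>
     (\<exists>F. homeomorphism G (f ` G) f F) \<and>
     (\<forall>z r. 0 < r \<and> cball z r \<subseteq> G \<longrightarrow> winding_number (f \<circ> circlepath z r) (f z) = 1)"

text \<open>A plane homeomorphism of class $W^{1,2}_{loc}$ is differentiable almost everywhere
  (Gehring--Lehto), and its weak partial derivatives agree almost everywhere with the classical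
  ones. The pointwise inequality is therefore stated with the classical differential.\<close>

definition quasiconformal_on :: "real \<Rightarrow> complex set \<Rightarrow> (complex \<Rightarrow> complex) \<Rightarrow> bool" where
  "quasiconformal_on K G f \<longleftrightarrow>
     open G \<and> connected G \<and> sense_preserving_homeo G f \<and> W12_loc G f \<and>
     (AE z\<in>G in lebesgue. (diff_norm f z)\<^sup>2 \<le> K * \<bar>jacobian f z\<bar>)"


subsection \<open>Harmonic univalent mappings\<close>

text \<open>The normalization at the origin makes \<open>h\<close> and \<open>g\<close> unique on the disk.\<close>

definition harmonic_repr ::
    "(complex \<Rightarrow> complex) \<Rightarrow> (complex \<Rightarrow> complex) \<Rightarrow> (complex \<Rightarrow> complex) \<Rightarrow> bool" where
  "harmonic_repr f h g \<longleftrightarrow>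
     h holomorphic_on \<D> \<and> g holomorphic_on \<D> \<and> h 0 = 0 \<and> g 0 = 0 \<and>
     (\<forall>z\<in>\<D>. f z = h z + cnj (g z))"

definition S_H :: "(complex \<Rightarrow> complex) set" where
  "S_H = {f. inj_on f \<D> \<and> (\<forall>z\<in>\<D>. 0 < jacobian f z) \<and>
             (\<exists>h g. harmonic_repr f h g \<and> deriv h 0 = 1)}"

definition S_H0 :: "(complex \<Rightarrow> complex) set" where
  "S_H0 = {f \<in> S_H. \<exists>h g. harmonic_repr f h g \<and> deriv g 0 = 0}"

definition S_H0_qc :: "real \<Rightarrow> complex set \<Rightarrow> (complex \<Rightarrow> complex) set" where
  "S_H0_qc K \<Omega> = {f \<in> S_H0. quasiconformal_on K \<D> f \<and> f ` \<D> = \<Omega>}"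

definition pre_schwarzian :: "(complex \<Rightarrow> complex) \<Rightarrow> complex \<Rightarrow> complex" where
  "pre_schwarzian f = wirtinger (\<lambda>z. of_real (ln (jacobian f z)))"


subsection \<open>Radial John disks\<close>

text \<open>The length is the total variation of \<open>\<gamma>\<close> over \<open>[a,b]\<close>. The endpoints of an interval
  \<open>I\<close> of a division are \<open>Inf I\<close> and \<open>Sup I\<close>.\<close>

definition curve_length :: "(real \<Rightarrow> complex) \<Rightarrow> real \<Rightarrow> real \<Rightarrow> ennreal" where
  "curve_length \<gamma> a b =
     (SUP d\<in>{d. d division_of {a..b}}. \<Sum>I\<in>d. ennreal (dist (\<gamma> (Inf I)) (\<gamma> (Sup I))))"

definition rectifiable_path :: "(real \<Rightarrow> complex) \<Rightarrow> bool" where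
  "rectifiable_path \<gamma> \<longleftrightarrow> path \<gamma> \<and> curve_length \<gamma> 0 1 < \<infinity>"

text \<open>The arc \<open>f([0,z])\<close> is traversed from \<open>f z\<close> to the center \<open>f 0\<close>.\<close>

definition radial_arc :: "(complex \<Rightarrow> complex) \<Rightarrow> complex \<Rightarrow> real \<Rightarrow> complex" where
  "radial_arc f z = f \<circ> linepath z 0"

definition radial_c_John_disk :: "real \<Rightarrow> (complex \<Rightarrow> complex) \<Rightarrow> complex set \<Rightarrow> bool" where
  "radial_c_John_disk c f G \<longleftrightarrow>
     1 \<le> c \<and> inj_on f \<D> \<and> G = f ` \<D> \<and>
     open G \<and> bounded G \<and> simply_connected G \<and>
     (\<forall>z\<in>\<D>. rectifiable_path (radial_arc f z) \<and>
        (\<forall>t\<in>{0..1}. curve_length (radial_arc f z) 0 t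
                        \<le> ennreal (c * infdist (radial_arc f z t) (frontier G))))"

definition radial_John_disk :: "(complex \<Rightarrow> complex) \<Rightarrow> complex set \<Rightarrow> bool" where
  "radial_John_disk f G \<longleftrightarrow> (\<exists>c. radial_c_John_disk c f G)"


subsection \<open>Boundary upper limits\<close>

text \<open>Upper limit as \<open>|z|\<close> tends to 1 from below, uniformly in the argument of \<open>z\<close>.\<close>

definition boundary_limsup :: "(complex \<Rightarrow> real) \<Rightarrow> ereal" where
  "boundary_limsup u = Limsup (filtercomap cmod (at_left 1)) (\<lambda>z. ereal (u z))"


subsection \<open>The expressions in terms of \<open>h\<close> and \<open>g\<close>\<close>

lemma harmonic_repr_has_derivative:
  assumes "harmonic_repr f h g" "z \<in> \<D>"
  shows "(f has_derivative (\<lambda>e. deriv h z * e + cnj (deriv g z * e))) (at z)"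
proof -
  have h: "(h has_derivative (*) (deriv h z)) (at z)"
    and g: "(g has_derivative (*) (deriv g z)) (at z)"
    using assms holomorphic_derivI[of _ \<D> z] unfolding harmonic_repr_def has_field_derivative_def
    by auto
  have "((\<lambda>z. h z + cnj (g z)) has_derivative
          (\<lambda>e. deriv h z * e + cnj (deriv g z * e))) (at z)"
    by (intro has_derivative_add h bounded_linear.has_derivative[OF bounded_linear_cnj g])
  then show ?thesis
    by (rule has_derivative_transform_within_open[of _ _ _ _ \<D>])
       (use assms in \<open>auto simp: harmonic_repr_def\<close>)
qed

lemma harmonic_repr_wirtinger:
  assumes "harmonic_repr f h g" "z \<in> \<D>"
  shows "wirtinger f z = deriv h z" "wirtinger_bar f z = cnj (deriv g z)"
    "jacobian f z = (cmod (deriv h z))\<^sup>2 - (cmod (deriv g z))\<^sup>2"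
proof -
  have "frechet_derivative f (at z) = (\<lambda>e. deriv h z * e + cnj (deriv g z * e))"
    using frechet_derivative_at[OF harmonic_repr_has_derivative[OF assms]] by simp
  then show "wirtinger f z = deriv h z" "wirtinger_bar f z = cnj (deriv g z)"
    by (simp_all add: wirtinger_def wirtinger_bar_def algebra_simps)
  then show "jacobian f z = (cmod (deriv h z))\<^sup>2 - (cmod (deriv g z))\<^sup>2"
    by (simp add: jacobian_def)
qed

lemma cmod2_has_derivative:
  assumes "(p has_field_derivative p') (at z)"
  shows "((\<lambda>z. (cmod (p z))\<^sup>2) has_derivative (\<lambda>e. 2 * Re (cnj (p z) * p' * e))) (at z)"
proof -
  have p: "(p has_derivative (\<lambda>e. p' * e)) (at z)"
    using assms by (simp add: has_field_derivative_def)
  have "((\<lambda>z. p z \<bullet> p z) has_derivative (\<lambda>e. p z \<bullet> (p' * e) + (p' * e) \<bullet> p z)) (at z)"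
    by (rule has_derivative_inner[OF p p])
  moreover have "(\<lambda>e. p z \<bullet> (p' * e) + (p' * e) \<bullet> p z) = (\<lambda>e. 2 * Re (cnj (p z) * p' * e))"
    by (auto simp: inner_complex_def algebra_simps)
  ultimately show ?thesis by (simp add: power2_norm_eq_inner)
qed

lemma pre_schwarzian_eq:
  assumes fhg: "harmonic_repr f h g" and z: "z \<in> \<D>" and J: "0 < jacobian f z"
  shows "pre_schwarzian f z =
    (deriv (deriv h) z * cnj (deriv h z) - deriv (deriv g) z * cnj (deriv g z)) /
      of_real ((cmod (deriv h z))\<^sup>2 - (cmod (deriv g z))\<^sup>2)"
proof -
  define A where "A = cnj (deriv h z) * deriv (deriv h) z - cnj (deriv g z) * deriv (deriv g) z"
  have dh: "(deriv h has_field_derivative deriv (deriv h) z) (at z)"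
    and dg: "(deriv g has_field_derivative deriv (deriv g) z) (at z)"
    using fhg z holomorphic_derivI[of _ \<D> z] holomorphic_deriv[of _ \<D>]
    unfolding harmonic_repr_def by auto
  let ?J = "\<lambda>z. (cmod (deriv h z))\<^sup>2 - (cmod (deriv g z))\<^sup>2"
  have "(?J has_derivative (\<lambda>e. 2 * Re (A * e))) (at z)"
    using has_derivative_diff[OF cmod2_has_derivative[OF dh] cmod2_has_derivative[OF dg]]
    by (simp add: A_def algebra_simps)
  then have dJ: "(jacobian f has_derivative (\<lambda>e. 2 * Re (A * e))) (at z)"
    by (rule has_derivative_transform_within_open[of _ _ _ _ \<D>])
       (use harmonic_repr_wirtinger[OF fhg] z in auto)
  have "((\<lambda>z. of_real (ln (jacobian f z)) :: complex) has_derivative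
          (\<lambda>e. of_real (2 * Re (A * e) * inverse (jacobian f z)))) (at z)"
    by (intro has_derivative_of_real has_derivative_ln[OF J dJ])
  from frechet_derivative_at[OF this, symmetric]
  have "pre_schwarzian f z =
      (of_real (2 * Re (A * 1) * inverse (jacobian f z))
        - \<i> * of_real (2 * Re (A * \<i>) * inverse (jacobian f z))) / 2"
    unfolding pre_schwarzian_def wirtinger_def by simp
  also have "\<dots> = A / of_real (jacobian f z)"
    using J by (simp add: complex_eq_iff field_simps)
  finally show ?thesis
    using harmonic_repr_wirtinger(3)[OF fhg z] by (simp add: A_def mult.commute)
qed

end

theory Submission
  imports Defs
begin

text \<open>
  Both parts rest on two facts about \<open>h'\<close>: it grows slowly along radii, and it bounds from below
  the distance of \<open>f(z)\<close> to the complement of \<open>\<Omega>\<close>.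

  Growth. The Pre-Schwarzian is the logarithmic derivative of the Jacobian, so
  \<open>r d/dr log J\<^sub>f = 2 Re (z P\<^sub>f)\<close>, and the hypothesis of (a) bounds the growth of \<open>J\<^sub>f\<close> near the
  boundary by that of \<open>(1 - r)\<close> to a power above \<open>-2\<close>. Since \<open>|g'| \<le> k |h'|\<close> by quasiconformality,
  \<open>J\<^sub>f\<close> is comparable with \<open>|h'|\<^sup>2\<close>; hence \<open>|h'(\<rho>\<zeta>)| \<le> C |h'(r\<zeta>)| ((1 - r) / (1 - \<rho>))\<^sup>a\<close> for \<open>r \<le> \<rho>\<close>
  with some \<open>a < 1\<close>. In (b) the expression inside the modulus is \<open>h'' / h'\<close>, and the same argument
  applies with \<open>|h'|\<^sup>2\<close> in place of \<open>J\<^sub>f\<close>. Because \<open>a < 1\<close>, integration along a radius shows that the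
  arc of \<open>f\<close> beyond \<open>r\<zeta>\<close> has length at most a constant times \<open>(1 - r) |h'(r\<zeta>)|\<close>. The two lemmas are
  \<open>radial_growth\<close> and \<open>radial_John_disk_of_growth\<close>.

  Distance. What remains is a Koebe-type estimate, \<open>harmonic_qc_Koebe\<close>: the distance from \<open>f(z)\<close> to
  any omitted value is at least \<open>c(k) (1 - |z|) |h'(z)|\<close>. After an affine normalization the map
  vanishes at \<open>0\<close> and omits \<open>1\<close>. Suppose \<open>|F(z)| \<ge> 1\<close> for a point \<open>z\<close> very close to \<open>0\<close>. Every circle
  around \<open>0\<close> that encloses \<open>z\<close> has an image that separates \<open>0\<close> and \<open>F(z)\<close> from \<open>1\<close>, so this image has a
  definite length inside a fixed disk. By the length-area principle each annulus of a given modulus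
  then contributes a definite area, measured by the Jacobian, inside that disk; as \<open>F\<close> is injective
  the total area is bounded, and \<open>|z|\<close> cannot be too small. Therefore \<open>|F| < 1\<close> on a disk whose
  radius depends only on \<open>k\<close>, and Cauchy's inequality bounds \<open>|F\<^sub>z(0)|\<close>.
\<close>


section \<open>Area of an injective image\<close>

text \<open>The change of variables formula for injective maps concerns Cartesian powers \<open>real^'n\<close>, whereas
  iterated integrals concern pairs; this isometry carries one setting to the other.\<close>

definition plane_vec :: "real \<times> real \<Rightarrow> real^2" where
  "plane_vec p = vector [fst p, snd p]"

lemma plane_vec_nth [simp]: "plane_vec p $ 1 = fst p" "plane_vec p $ 2 = snd p"
  by (simp_all add: plane_vec_def)

lemma plane_vec_measurable [measurable]: "plane_vec \<in> borel_measurable borel"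
proof (rule borel_measurable_continuous_onI)
  have "continuous_on UNIV (\<lambda>p::real \<times> real. \<chi> i. if i = (1::2) then fst p else snd p)"
  proof (rule continuous_on_vec_lambda)
    show "continuous_on UNIV (\<lambda>p::real \<times> real. if i = (1::2) then fst p else snd p)" for i
      by (cases "i = 1") (auto intro!: continuous_intros)
  qed
  moreover have "plane_vec = (\<lambda>p. \<chi> i. if i = (1::2) then fst p else snd p)"
    by (auto simp: vec_eq_iff forall_2)
  ultimately show "continuous_on UNIV plane_vec" by metis
qed

lemma Basis_real2: "(Basis :: (real^2) set) = {axis 1 1, axis 2 1}"
  by (auto simp: Basis_vec_def UNIV_2)

lemma lborel_plane_vec: "distr lborel borel plane_vec = lborel"
proof (rule lborel_eqI[symmetric])
  fix l u :: "real^2"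
  assume le: "\<And>b. b \<in> Basis \<Longrightarrow> l \<bullet> b \<le> u \<bullet> b"
  have 1: "l $ 1 \<le> u $ 1" "l $ 2 \<le> u $ 2"
    using le[of "axis 1 1"] le[of "axis 2 1"] by (auto simp: Basis_real2 inner_axis)
  have "plane_vec -` box l u = box (l $ 1, l $ 2) (u $ 1, u $ 2)"
    by (auto simp: mem_box mem_box_cart[of _ l u, unfolded mem_box] forall_2 Basis_prod_def mem_box_cart)
  then have "emeasure (distr lborel borel plane_vec) (box l u)
      = emeasure lborel (box (l $ 1, l $ 2) (u $ 1, u $ 2))"
    by (subst emeasure_distr) auto
  also have "\<dots> = ennreal ((u $ 1 - l $ 1) * (u $ 2 - l $ 2))"
    using 1 by (subst emeasure_lborel_box)
      (auto simp: Basis_prod_def sum.union_disjoint prod.union_disjoint inner_Pair image_iff)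
  also have "\<dots> = (\<Prod>b\<in>Basis. (u - l) \<bullet> b)"
    by (simp add: Basis_real2 inner_axis axis_eq_axis)
  finally show "emeasure (distr lborel borel plane_vec) (box l u) = ennreal (\<Prod>b\<in>Basis. (u - l) \<bullet> b)" .
qed auto

lemma nn_integral_real2:
  assumes [measurable]: "p \<in> borel_measurable (borel :: (real^2) measure)"
  shows "(\<integral>\<^sup>+v. p v \<partial>lborel) = (\<integral>\<^sup>+x. \<integral>\<^sup>+y. p (plane_vec (x, y)) \<partial>lborel \<partial>lborel)"
proof -
  have "(\<integral>\<^sup>+v. p v \<partial>lborel) = (\<integral>\<^sup>+q. p (plane_vec q) \<partial>lborel)"
    by (subst lborel_plane_vec[symmetric], subst nn_integral_distr) auto
  also have "\<dots> = (\<integral>\<^sup>+q. p (plane_vec q) \<partial>(lborel \<Otimes>\<^sub>M lborel))"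
    by (simp add: lborel_prod)
  also have "\<dots> = (\<integral>\<^sup>+x. \<integral>\<^sup>+y. p (plane_vec (x, y)) \<partial>lborel \<partial>lborel)"
    by (subst lborel.nn_integral_fst[symmetric]) (simp_all add: lborel_prod)
  finally show ?thesis .
qed

text \<open>The left-hand side is the area of \<open>u ` S\<close>, and this set lies in a square of side \<open>2 * R\<close>. With
  \<open>A\<close> and \<open>B\<close> as the two Wirtinger coefficients of the differential, its determinant is
  \<open>|A|\<^sup>2 - |B|\<^sup>2\<close>.\<close>

lemma nn_integral_jacobian_le:
  fixes u A B :: "complex \<Rightarrow> complex"
  assumes S: "open S" and inj: "inj_on u S"
    and der: "\<And>z. z \<in> S \<Longrightarrow> (u has_derivative (\<lambda>e. A z * e + cnj (B z * e))) (at z)"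
    and contA: "continuous_on S A" and contB: "continuous_on S B"
    and BA: "\<And>z. z \<in> S \<Longrightarrow> cmod (B z) \<le> cmod (A z)"
    and R: "u ` S \<subseteq> ball 0 R" "0 \<le> R"
  shows "(\<integral>\<^sup>+x. \<integral>\<^sup>+y. ennreal (indicator S (Complex x y)
            * ((cmod (A (Complex x y)))\<^sup>2 - (cmod (B (Complex x y)))\<^sup>2)) \<partial>lborel \<partial>lborel)
         \<le> ennreal (4 * R\<^sup>2)"
proof -
  define toC where "toC = (\<lambda>v::real^2. Complex (v $ 1) (v $ 2))"
  define toV where "toV = (\<lambda>z. plane_vec (Re z, Im z))"
  have toC_toV [simp]: "toC (toV z) = z" for z by (simp add: toC_def toV_def)
  have toV_toC [simp]: "toV (toC v) = v" for v by (simp add: toC_def toV_def vec_eq_iff forall_2)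
  have linC: "bounded_linear toC"
    by (intro linear_conv_bounded_linear[THEN iffD1] linearI) (auto simp: toC_def complex_eq_iff)
  have linV: "bounded_linear toV"
    by (intro linear_conv_bounded_linear[THEN iffD1] linearI)
       (auto simp: toV_def vec_eq_iff forall_2)
  define S' where "S' = toC -` S"
  have contC: "continuous_on UNIV toC"
    using linC by (simp add: linear_continuous_on)
  have openS': "open S'"
    unfolding S'_def using S contC by (simp add: open_vimage)
  define U where "U = toV \<circ> u \<circ> toC"
  define U' where "U' = (\<lambda>v e. toV (A (toC v) * toC e + cnj (B (toC v) * toC e)))"
  have derU: "(U has_derivative U' v) (at v)" if "v \<in> S'" for v
  proof -
    have "(toC has_derivative toC) (at v)"
      by (rule bounded_linear_imp_has_derivative[OF linC])
    from diff_chain_at[OF this der[of "toC v"]] that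
    have "(u \<circ> toC has_derivative (\<lambda>e. A (toC v) * toC e + cnj (B (toC v) * toC e))) (at v)"
      by (auto simp: S'_def o_def)
    from bounded_linear.has_derivative[OF linV this]
    show ?thesis by (simp add: U_def U'_def o_def)
  qed
  have det: "det (matrix (U' v)) = (cmod (A (toC v)))\<^sup>2 - (cmod (B (toC v)))\<^sup>2" for v
  proof -
    have [simp]: "toC (axis 1 1) = 1" "toC (axis 2 1) = \<i>"
      by (auto simp: toC_def axis_def complex_eq_iff)
    show ?thesis
      unfolding det_2 matrix_def U'_def toV_def
      by (simp add: cmod_power2) (simp add: power2_eq_square algebra_simps)
  qed
  have injU: "inj_on U S'"
    unfolding U_def
  proof (intro comp_inj_on)
    show "inj_on toC S'" by (metis inj_onI toV_toC)
    show "inj_on u (toC ` S')" using inj by (rule inj_on_subset) (auto simp: S'_def)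
    show "inj_on toV (u ` toC ` S')" by (metis inj_onI toC_toV)
  qed
  have "continuous_on S' U"
    using derU by (meson continuous_at_imp_continuous_on has_derivative_continuous)
  from invariance_of_domain[OF this openS' injU] have openU: "open (U ` S')" .
  have box: "U ` S' \<subseteq> cbox (plane_vec (-R, -R)) (plane_vec (R, R))"
  proof safe
    fix v assume "v \<in> S'"
    then have "cmod (u (toC v)) < R" using R by (auto simp: S'_def)
    then have "\<bar>Re (u (toC v))\<bar> < R" "\<bar>Im (u (toC v))\<bar> < R"
      using abs_Re_le_cmod[of "u (toC v)"] abs_Im_le_cmod[of "u (toC v)"] by linarith+
    then show "U v \<in> cbox (plane_vec (-R, -R)) (plane_vec (R, R))"
      by (auto simp: mem_box_cart forall_2 U_def toV_def)
  qed
  have meas: "U ` S' \<in> lmeasurable"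
    using openU box by (meson bounded_cbox bounded_subset lmeasurable_open)
  have "measure lebesgue (U ` S') \<le> measure lebesgue (cbox (plane_vec (-R, -R)) (plane_vec (R, R)))"
    using meas box by (intro measure_mono_fmeasurable) (auto simp: fmeasurableD)
  also have "\<dots> = 4 * R\<^sup>2"
  proof -
    have "cbox (plane_vec (-R, -R)) (plane_vec (R, R)) \<noteq> {}"
      using R by (simp add: interval_ne_empty_cart forall_2)
    then show ?thesis by (simp add: content_cbox_cart UNIV_2 power2_eq_square)
  qed
  finally have le: "measure lebesgue (U ` S') \<le> 4 * R\<^sup>2" .
  have "((\<lambda>v. \<bar>det (matrix (U' v))\<bar>) has_integral measure lebesgue (U ` S')) S'"
  proof -
    have "S' \<in> sets lebesgue" using openS' by auto
    from has_measure_differentiable_image[OF this has_derivative_at_withinI[OF derU] injU] meas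
    show ?thesis by blast
  qed
  then have int: "((\<lambda>v. indicator S (toC v) * ((cmod (A (toC v)))\<^sup>2 - (cmod (B (toC v)))\<^sup>2))
      has_integral measure lebesgue (U ` S')) UNIV"
    unfolding has_integral_restrict_UNIV[of S', symmetric]
    by (rule has_integral_eq[rotated])
       (use BA in \<open>auto simp: det S'_def indicator_def power_mono\<close>)
  have "continuous_on S' (\<lambda>v. (cmod (A (toC v)))\<^sup>2 - (cmod (B (toC v)))\<^sup>2)"
    by (intro continuous_intros continuous_on_compose2[OF contA] continuous_on_compose2[OF contB]
        continuous_on_subset[OF contC]) (auto simp: S'_def)
  then have "(\<lambda>v. indicator S' v *\<^sub>R ((cmod (A (toC v)))\<^sup>2 - (cmod (B (toC v)))\<^sup>2)) \<in> borel_measurable borel"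
    using openS' by (intro borel_measurable_continuous_on_indicator) auto
  moreover have "indicator S' v = (indicator S (toC v) :: real)" for v
    by (simp add: S'_def indicator_def)
  ultimately have m: "(\<lambda>v. indicator S (toC v) * ((cmod (A (toC v)))\<^sup>2 - (cmod (B (toC v)))\<^sup>2)) \<in> borel_measurable borel"
    by simp
  have "(\<integral>\<^sup>+v. ennreal (indicator S (toC v) * ((cmod (A (toC v)))\<^sup>2 - (cmod (B (toC v)))\<^sup>2)) \<partial>lborel)
      = ennreal (measure lebesgue (U ` S'))"
    by (rule nn_integral_has_integral_lborel[OF m _ int])
       (use BA in \<open>auto simp: indicator_def power_mono\<close>)
  with le m show ?thesis
    by (subst (asm) nn_integral_real2) (auto simp: toC_def intro: ennreal_leI)
qed


section \<open>Length of a curve inside a disk\<close>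

text \<open>Until the curve has first moved by \<open>d\<close> away from its starting point it stays in the disk of
  radius \<open>r + d\<close>, and it needs length at least \<open>d\<close> to do so. This is how a curve that may wander off to
  infinity is charged only for the part that lies in a bounded region.\<close>

lemma length_in_disk_ge_aux:
  fixes \<gamma> \<gamma>' :: "real \<Rightarrow> complex"
  assumes der: "\<And>x. x \<in> {a..b} \<Longrightarrow> (\<gamma> has_vector_derivative \<gamma>' x) (at x)"
    and cont: "continuous_on {a..b} \<gamma>'"
    and st: "s \<in> {a..b}" "t \<in> {a..b}" "s \<le> t"
    and r: "cmod (\<gamma> s) \<le> r" and d: "d \<le> cmod (\<gamma> t - \<gamma> s)"
  shows "ennreal d \<le> (\<integral>\<^sup>+x. ennreal (indicator {x \<in> {a..b}. cmod (\<gamma> x) < r + d} x * cmod (\<gamma>' x)) \<partial>lborel)"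
proof -
  \<comment> \<open>the infimum of \<open>T\<close> is the first time of displacement \<open>d\<close>\<close>
  define T where "T = {x \<in> {s..t}. d \<le> cmod (\<gamma> x - \<gamma> s)}"
  have contg: "continuous_on {a..b} \<gamma>"
    using der by (meson continuous_at_imp_continuous_on has_vector_derivative_continuous)
  have "closed T"
    unfolding T_def using st
    by (intro continuous_on_closed_Collect_le continuous_intros continuous_on_subset[OF contg]) auto
  moreover have "T \<noteq> {}" "bdd_below T"
    using st d by (auto simp: T_def)
  ultimately have Inf: "Inf T \<in> T" "\<And>x. x \<in> T \<Longrightarrow> Inf T \<le> x"
    by (auto simp: closed_contains_Inf cInf_lower)
  define q where "q = Inf T"
  have q: "s \<le> q" "q \<le> t" "d \<le> cmod (\<gamma> q - \<gamma> s)"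
    using Inf by (auto simp: T_def q_def)
  have early: "cmod (\<gamma> x) < r + d" if "s \<le> x" "x < q" for x
  proof -
    have "x \<notin> T" using Inf(2)[of x] that by (auto simp: q_def)
    then have "cmod (\<gamma> x - \<gamma> s) < d" using that q by (auto simp: T_def)
    then show ?thesis using r norm_triangle_ineq[of "\<gamma> x - \<gamma> s" "\<gamma> s"] by simp
  qed
  have sub: "{s..q} \<subseteq> {a..b}" using q st by auto
  have contn: "continuous_on {s..q} (\<lambda>x. cmod (\<gamma>' x))"
    using continuous_on_subset[OF cont sub] by (intro continuous_intros)
  have I: "(\<gamma>' has_integral (\<gamma> q - \<gamma> s)) {s..q}"
  proof (rule fundamental_theorem_of_calculus[OF q(1)])
    show "(\<gamma> has_vector_derivative \<gamma>' x) (at x within {s..q})" if "x \<in> {s..q}" for x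
      using der[of x] that sub by (meson has_vector_derivative_at_within subsetD)
  qed
  have int: "(\<lambda>x. cmod (\<gamma>' x)) integrable_on {s..q}"
    using contn by (rule integrable_continuous_real)
  have "d \<le> integral {s..q} (\<lambda>x. cmod (\<gamma>' x))"
    using integral_norm_bound_integral[OF has_integral_integrable[OF I] int] q I
    by (simp add: integral_unique)
  then have "ennreal d \<le> ennreal (integral {s..q} (\<lambda>x. cmod (\<gamma>' x)))"
    by (rule ennreal_leI)
  also have "ennreal (integral {s..q} (\<lambda>x. cmod (\<gamma>' x))) = (\<integral>\<^sup>+x. ennreal (indicator {s..q} x * cmod (\<gamma>' x)) \<partial>lborel)"
  proof (rule sym, rule nn_integral_has_integral_lborel)
    show "(\<lambda>x. indicator {s..q} x * cmod (\<gamma>' x)) \<in> borel_measurable borel"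
      using borel_measurable_continuous_on_indicator[OF _ contn] by simp
    show "((\<lambda>x. indicator {s..q} x * cmod (\<gamma>' x)) has_integral integral {s..q} (\<lambda>x. cmod (\<gamma>' x))) UNIV"
    proof -
      have eq: "(\<lambda>x. indicator {s..q} x * cmod (\<gamma>' x)) = (\<lambda>x. if x \<in> {s..q} then cmod (\<gamma>' x) else 0)"
        by (auto simp: indicator_def)
      show ?thesis
        unfolding eq has_integral_restrict_UNIV using int by (rule integrable_integral)
    qed
  qed auto
  also have "\<dots> \<le> (\<integral>\<^sup>+x. ennreal (indicator {x \<in> {a..b}. cmod (\<gamma> x) < r + d} x * cmod (\<gamma>' x)) \<partial>lborel)"
  proof (rule nn_integral_mono_AE)
    show "AE x in lborel. ennreal (indicator {s..q} x * cmod (\<gamma>' x))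
        \<le> ennreal (indicator {x \<in> {a..b}. cmod (\<gamma> x) < r + d} x * cmod (\<gamma>' x))"
      using AE_lborel_singleton[of q]
    proof eventually_elim
      case (elim x)
      show ?case
      proof (cases "x \<in> {s..q}")
        case True
        with elim early[of x] sub have "x \<in> {x \<in> {a..b}. cmod (\<gamma> x) < r + d}"
          by fastforce
        then show ?thesis by (simp add: indicator_def)
      qed simp
    qed
  qed
  finally show ?thesis .
qed

text \<open>The order of the two parameters does not matter: reverse the curve.\<close>

lemma length_in_disk_ge:
  fixes \<gamma> \<gamma>' :: "real \<Rightarrow> complex"
  assumes der: "\<And>x. x \<in> {a..b} \<Longrightarrow> (\<gamma> has_vector_derivative \<gamma>' x) (at x)"
    and cont: "continuous_on {a..b} \<gamma>'"
    and st: "s \<in> {a..b}" "t \<in> {a..b}"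
    and r: "cmod (\<gamma> s) \<le> r" and d: "d \<le> cmod (\<gamma> t - \<gamma> s)"
  shows "ennreal d \<le> (\<integral>\<^sup>+x. ennreal (indicator {x \<in> {a..b}. cmod (\<gamma> x) < r + d} x * cmod (\<gamma>' x)) \<partial>lborel)"
proof (cases "s \<le> t")
  case True
  then show ?thesis using length_in_disk_ge_aux[OF der cont st _ r d] by simp
next
  case False
  let ?g = "\<lambda>x. indicator {x \<in> {a..b}. cmod (\<gamma> x) < r + d} x * cmod (\<gamma>' x)"
  have "ennreal d \<le> (\<integral>\<^sup>+x. ennreal (indicator {x \<in> {-b..-a}. cmod ((\<gamma> \<circ> uminus) x) < r + d} x
      * cmod (- \<gamma>' (- x))) \<partial>lborel)"
  proof (rule length_in_disk_ge_aux[where s = "-s" and t = "-t"])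
    show "(\<gamma> \<circ> uminus has_vector_derivative - \<gamma>' (- x)) (at x)" if "x \<in> {-b..-a}" for x
    proof -
      have "((\<gamma> \<circ> uminus) has_vector_derivative (-1) *\<^sub>R \<gamma>' (- x)) (at x)"
        by (rule vector_diff_chain_at) (use that der in \<open>auto intro!: derivative_eq_intros\<close>)
      then show ?thesis by simp
    qed
    show "continuous_on {-b..-a} (\<lambda>x. - \<gamma>' (- x))"
      by (intro continuous_intros continuous_on_compose2[OF cont]) auto
  qed (use False st r d in auto)
  also have "\<dots> = (\<integral>\<^sup>+x. ennreal (?g (- x)) \<partial>lborel)"
    by (intro nn_integral_cong) (auto simp: indicator_def)
  also have "\<dots> = (\<integral>\<^sup>+x. ennreal (?g x) \<partial>lborel)"
  proof -
    have "continuous_on {a..b} \<gamma>"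
      using der by (meson continuous_at_imp_continuous_on has_vector_derivative_continuous)
    then have "(\<lambda>x. indicator {a..b} x *\<^sub>R \<gamma> x) \<in> borel_measurable borel"
      by (intro borel_measurable_continuous_on_indicator) auto
    then have [measurable]: "{x \<in> {a..b}. cmod (\<gamma> x) < r + d} \<in> sets borel"
    proof -
      assume [measurable]: "(\<lambda>x. indicator {a..b} x *\<^sub>R \<gamma> x) \<in> borel_measurable borel"
      have "{x \<in> {a..b}. cmod (indicator {a..b} x *\<^sub>R \<gamma> x) < r + d} \<in> sets borel"
        by measurable
      also have "{x \<in> {a..b}. cmod (indicator {a..b} x *\<^sub>R \<gamma> x) < r + d} = {x \<in> {a..b}. cmod (\<gamma> x) < r + d}"
        by auto
      finally show ?thesis .
    qed
    have [measurable]: "(\<lambda>x. indicator {a..b} x *\<^sub>R \<gamma>' x) \<in> borel_measurable borel"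
      using cont by (intro borel_measurable_continuous_on_indicator) auto
    have "(\<lambda>x. indicator {x \<in> {a..b}. cmod (\<gamma> x) < r + d} x * cmod (indicator {a..b} x *\<^sub>R \<gamma>' x)) \<in> borel_measurable borel"
      by measurable
    also have "(\<lambda>x. indicator {x \<in> {a..b}. cmod (\<gamma> x) < r + d} x * cmod (indicator {a..b} x *\<^sub>R \<gamma>' x)) = ?g"
      by (auto simp: indicator_def)
    finally have [measurable]: "?g \<in> borel_measurable borel" .
    define G where "G = ?g"
    have "(\<lambda>x. ennreal (G x)) \<in> borel_measurable borel"
      unfolding G_def by measurable
    from nn_integral_real_affine[OF this, of "-1" 0]
    have "(\<integral>\<^sup>+x. ennreal (G (- x)) \<partial>lborel) = (\<integral>\<^sup>+x. ennreal (G x) \<partial>lborel)"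
      by simp
    then show ?thesis unfolding G_def .
  qed
  finally show ?thesis .
qed


section \<open>Koebe-type distortion of quasiconformal harmonic maps\<close>

text \<open>The image \<open>V\<close> of the disk of radius \<open>\<rho>\<close> is open and its frontier lies on the image of the
  circle. The segment from \<open>0\<close> to the omitted value \<open>1\<close> has to leave \<open>V\<close>, which gives \<open>p\<close>. If the image
  of the circle were contained in a small disk around \<open>F p\<close>, then so would be \<open>V\<close>, since the
  complement of a disk is connected; but \<open>V\<close> contains both \<open>0\<close> and \<open>F z\<close>.\<close>

lemma circle_image_large:
  fixes F :: "complex \<Rightarrow> complex"
  assumes cont: "continuous_on \<D> F" and inj: "inj_on F \<D>"
    and F0: "F 0 = 0" and omit: "1 \<notin> F ` \<D>"
    and \<rho>: "cmod z < \<rho>" "\<rho> < 1" and z: "1 \<le> cmod (F z)"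
  obtains p q where "cmod p = \<rho>" "cmod q = \<rho>" "cmod (F p) \<le> 1" "1 / 2 \<le> cmod (F q - F p)"
proof -
  have \<rho>0: "0 < \<rho>" using \<rho>(1) norm_ge_zero[of z] by linarith
  define V where "V = F ` ball 0 \<rho>"
  have subs: "cball 0 \<rho> \<subseteq> \<D>" "ball 0 \<rho> \<subseteq> \<D>" using \<rho> by auto
  have "open V"
    unfolding V_def using cont inj subs
    by (intro invariance_of_domain) (auto intro: continuous_on_subset inj_on_subset)
  have comp: "compact (F ` cball 0 \<rho>)"
    using cont subs by (intro compact_continuous_image) (auto intro: continuous_on_subset)
  then have "closure V \<subseteq> F ` cball 0 \<rho>"
    unfolding V_def by (intro closure_minimal image_mono compact_imp_closed) auto
  then have front: "frontier V \<subseteq> F ` sphere 0 \<rho>"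
    using \<open>open V\<close> unfolding frontier_def V_def by (force simp: interior_open)
  have V0: "0 \<in> V" "F z \<in> V" using F0 \<rho> \<rho>0 by (auto simp: V_def image_iff intro: bexI[of _ 0])
  have "closed_segment 0 1 \<inter> frontier V \<noteq> {}"
  proof (rule connected_Int_frontier)
    have "1 \<notin> V" using omit subs unfolding V_def by blast
    then show "closed_segment 0 1 - V \<noteq> {}" using ends_in_segment(2)[of 0 "1::complex"] by blast
    show "closed_segment 0 1 \<inter> V \<noteq> {}" using V0 ends_in_segment(1)[of 0 "1::complex"] by blast
  qed simp
  then obtain p where p: "cmod p = \<rho>" "F p \<in> closed_segment 0 1" using front by force
  then have "cmod (F p) \<le> 1" using segment_bound(1)[of "F p" 0 1] by simp
  moreover have "\<exists>q. cmod q = \<rho> \<and> 1 / 2 \<le> cmod (F q - F p)"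
  proof (rule ccontr)
    assume "\<not> ?thesis"
    then have small: "F ` sphere 0 \<rho> \<subseteq> ball (F p) (1/2)"
      by (auto simp: dist_norm norm_minus_commute not_le)
    have "V \<subseteq> ball (F p) (1/2)"
    proof (rule ccontr)
      assume "\<not> V \<subseteq> ball (F p) (1/2)"
      moreover have "bounded (V \<union> ball (F p) (1/2))"
        using comp subs unfolding V_def
        by (meson ball_subset_cball bounded_Un bounded_ball bounded_subset compact_imp_bounded image_mono)
      then have "V \<union> ball (F p) (1/2) \<noteq> UNIV"
        using not_bounded_UNIV by metis
      then have "- ball (F p) (1/2) - V \<noteq> {}" by auto
      ultimately have "- ball (F p) (1/2) \<inter> frontier V \<noteq> {}"
        by (intro connected_Int_frontier connected_complement_bounded_convex) auto
      then show False using small front by blast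
    qed
    then have "dist (F p) 0 < 1/2" "dist (F p) (F z) < 1/2" using V0 by auto
    then have "dist 0 (F z) < 1" using dist_triangle_less_add[of 0 "F p" "1/2" "F z" "1/2"]
      by (simp add: dist_commute)
    then show False using z by simp
  qed
  ultimately show ?thesis using p that by blast
qed

text \<open>The length-area argument. In the coordinate \<open>\<zeta> = log z\<close>, circles become vertical segments of length
  \<open>2 * pi\<close> and the annulus between \<open>|z|\<close> and \<open>1\<close> becomes a rectangle of width \<open>M = - ln |z|\<close>. On each
  segment the Jacobian, restricted to the part that \<open>F\<close> maps into the disk of radius \<open>3/2\<close>, has integral
  at least \<open>(1 - k\<^sup>2) / (32 * pi)\<close>, while the whole area is at most \<open>4 * (3/2)\<^sup>2 = 9\<close>. So
  \<open>M \<le> 288 * pi / (1 - k\<^sup>2)\<close>.\<close>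

lemma near_center_bounded:
  fixes H G :: "complex \<Rightarrow> complex"
  defines "F \<equiv> \<lambda>z. H z + cnj (G z)"
  assumes hol: "H holomorphic_on \<D>" "G holomorphic_on \<D>" and inj: "inj_on F \<D>"
    and k: "0 \<le> k" "k < 1" and dil: "\<And>z. z \<in> \<D> \<Longrightarrow> cmod (deriv G z) \<le> k * cmod (deriv H z)"
    and F0: "F 0 = 0" and omit: "1 \<notin> F ` \<D>"
    and z: "z \<in> \<D>" "1 \<le> cmod (F z)"
  shows "exp (- (288 * pi / (1 - k\<^sup>2))) \<le> cmod z"
proof -
  have z0: "0 < cmod z" using F0 z by auto
  define M where "M = - ln (cmod z)"
  have M: "0 < M" using z z0 by (simp add: M_def)
  define A where "A = (\<lambda>\<zeta>. deriv H (exp \<zeta>) * exp \<zeta>)"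
  define B where "B = (\<lambda>\<zeta>. deriv G (exp \<zeta>) * exp \<zeta>)"
  define u where "u = (\<lambda>\<zeta>. F (exp \<zeta>))"
  define L where "L = {\<zeta>. Re \<zeta> < 0}"
  define S where "S = {\<zeta>. - M < Re \<zeta> \<and> Re \<zeta> < 0 \<and> 0 < Im \<zeta> \<and> Im \<zeta> < 2 * pi} \<inter> {\<zeta> \<in> L. cmod (u \<zeta>) < 3 / 2}"
  have expD: "exp \<zeta> \<in> \<D>" if "\<zeta> \<in> L" for \<zeta> using that by (simp add: L_def)
  have openL: "open L" by (simp add: L_def open_halfspace_Re_lt)
  have derF: "(F has_derivative (\<lambda>e. deriv H w * e + cnj (deriv G w * e))) (at w)" if "w \<in> \<D>" for w
  proof -
    have "(H has_derivative (*) (deriv H w)) (at w)" "(G has_derivative (*) (deriv G w)) (at w)"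
      using hol that holomorphic_derivI[of _ \<D> w] unfolding has_field_derivative_def by auto
    then show ?thesis unfolding F_def
      by (intro has_derivative_add bounded_linear.has_derivative[OF bounded_linear_cnj])
  qed
  have contF: "continuous_on \<D> F"
    using derF by (meson continuous_at_imp_continuous_on has_derivative_continuous)
  have deru: "(u has_derivative (\<lambda>e. A \<zeta> * e + cnj (B \<zeta> * e))) (at \<zeta>)" if "\<zeta> \<in> L" for \<zeta>
  proof -
    have "(exp has_derivative (\<lambda>e. exp \<zeta> * e)) (at \<zeta>)"
      using DERIV_exp[of \<zeta>] by (simp add: has_field_derivative_def)
    from diff_chain_at[OF this derF[OF expD[OF that]]]
    show ?thesis by (simp add: u_def A_def B_def o_def mult_ac)
  qed
  have contu: "continuous_on L u"
    using deru by (meson continuous_at_imp_continuous_on has_derivative_continuous)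
  have dH: "deriv H holomorphic_on \<D>" and dG: "deriv G holomorphic_on \<D>"
    using hol by (auto intro: holomorphic_deriv)
  have expL: "exp ` L \<subseteq> \<D>" using expD by blast
  have contexp: "continuous_on L exp" by (intro continuous_intros)
  have contA: "continuous_on L A"
    unfolding A_def
    by (intro continuous_on_mult contexp
        continuous_on_compose2[OF holomorphic_on_imp_continuous_on[OF dH] contexp expL])
  have contB: "continuous_on L B"
    unfolding B_def
    by (intro continuous_on_mult contexp
        continuous_on_compose2[OF holomorphic_on_imp_continuous_on[OF dG] contexp expL])
  have dilAB: "cmod (B \<zeta>) \<le> k * cmod (A \<zeta>)" if "\<zeta> \<in> L" for \<zeta>
    using mult_right_mono[OF dil[OF expD[OF that]], of "cmod (exp \<zeta>)"]
    by (simp add: A_def B_def norm_mult mult_ac)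
  have "open (L \<inter> u -` ball 0 (3/2))"
    using continuous_open_preimage[OF contu openL open_ball] .
  moreover have "open {\<zeta>. - M < Re \<zeta> \<and> Re \<zeta> < 0 \<and> 0 < Im \<zeta> \<and> Im \<zeta> < 2 * pi}"
    by (intro open_Collect_conj open_Collect_less continuous_intros)
  moreover have "L \<inter> u -` ball 0 (3/2) = {\<zeta> \<in> L. cmod (u \<zeta>) < 3 / 2}" by auto
  ultimately have openS: "open S" by (simp only: S_def open_Int)
  have SL: "S \<subseteq> L" by (auto simp: S_def)
  have injS: "inj_on u S"
  proof (rule inj_onI)
    fix a b assume ab: "a \<in> S" "b \<in> S" "u a = u b"
    then have "exp a = exp b"
      using inj expD SL unfolding u_def by (meson inj_onD subsetD)
    moreover have "\<bar>Im a - Im b\<bar> < 2 * pi" using ab by (auto simp: S_def)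
    ultimately show "a = b" by (rule exp_complex_eqI[rotated])
  qed
  have k2: "k\<^sup>2 < 1" using k by (simp add: power_less_one_iff abs_square_less_1)
  have dil2: "(1 - k\<^sup>2) * (cmod (A \<zeta>))\<^sup>2 \<le> (cmod (A \<zeta>))\<^sup>2 - (cmod (B \<zeta>))\<^sup>2" if "\<zeta> \<in> L" for \<zeta>
    using power_mono[OF dilAB[OF that], of 2] by (simp add: power_mult_distrib algebra_simps)
  have area: "(\<integral>\<^sup>+x. \<integral>\<^sup>+y. ennreal (indicator S (Complex x y)
            * ((cmod (A (Complex x y)))\<^sup>2 - (cmod (B (Complex x y)))\<^sup>2)) \<partial>lborel \<partial>lborel)
         \<le> ennreal (4 * (3/2)\<^sup>2)"
  proof (rule nn_integral_jacobian_le[OF openS injS])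
    show "(u has_derivative (\<lambda>e. A \<zeta> * e + cnj (B \<zeta> * e))) (at \<zeta>)" if "\<zeta> \<in> S" for \<zeta>
      using deru SL that by blast
    show "continuous_on S A" "continuous_on S B"
      using contA contB SL continuous_on_subset by blast+
    show "cmod (B \<zeta>) \<le> cmod (A \<zeta>)" if "\<zeta> \<in> S" for \<zeta>
      using dilAB[of \<zeta>] SL that k mult_right_mono[of k 1 "cmod (A \<zeta>)"] by fastforce
    show "u ` S \<subseteq> ball 0 (3/2)" by (auto simp: S_def)
  qed simp
  have slice: "ennreal ((1 - k\<^sup>2) / (32 * pi)) \<le> (\<integral>\<^sup>+y. ennreal (indicator S (Complex x y)
            * ((cmod (A (Complex x y)))\<^sup>2 - (cmod (B (Complex x y)))\<^sup>2)) \<partial>lborel)"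
    if x: "- M < x" "x < 0" for x
  proof -
    define \<rho> where "\<rho> = exp x"
    have \<rho>: "cmod z < \<rho>" "\<rho> < 1" "0 < \<rho>"
      using x z0 exp_less_mono[of "- M" x] by (auto simp: \<rho>_def M_def)
    obtain p q where pq: "cmod p = \<rho>" "cmod q = \<rho>" "cmod (F p) \<le> 1" "1/2 \<le> cmod (F q - F p)"
      using circle_image_large[OF contF inj F0 omit \<rho>(1,2) z(2)] by blast
    have polar: "\<exists>s\<in>{0..2*pi}. p = exp (Complex x s)" if "cmod p = \<rho>" for p
    proof -
      have "exp (Complex x (Arg2pi p)) = of_real (cmod p) * cis (Arg2pi p)"
        by (subst exp_eq_polar) (simp add: that \<rho>_def)
      also have "\<dots> = p"
        unfolding cis_conv_exp by (rule Arg2pi_eq[symmetric])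
      finally have "p = exp (Complex x (Arg2pi p))" by (rule sym)
      moreover have "Arg2pi p \<in> {0..2*pi}"
        using Arg2pi_ge_0[of p] Arg2pi_lt_2pi[of p] by simp
      ultimately show ?thesis by blast
    qed
    obtain s t where s: "s \<in> {0..2*pi}" "p = exp (Complex x s)" and t: "t \<in> {0..2*pi}" "q = exp (Complex x t)"
      using polar[OF pq(1)] polar[OF pq(2)] by blast
    define \<gamma> where "\<gamma> = (\<lambda>y. u (Complex x y))"
    define \<gamma>' where "\<gamma>' = (\<lambda>y. A (Complex x y) * \<i> + cnj (B (Complex x y) * \<i>))"
    have line: "Complex x y \<in> L" for y using x by (simp add: L_def)
    have contline: "continuous_on UNIV (Complex x)"
      unfolding Complex_eq by (intro continuous_intros)
    have derg: "(\<gamma> has_vector_derivative \<gamma>' y) (at y)" for y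
    proof -
      have "(Complex x has_derivative (\<lambda>h. h *\<^sub>R \<i>)) (at y)"
        unfolding Complex_eq by (auto intro!: derivative_eq_intros simp: scaleR_conv_of_real)
      from diff_chain_at[OF this deru[OF line]]
      show ?thesis
        by (simp add: \<gamma>_def \<gamma>'_def o_def has_vector_derivative_def scaleR_conv_of_real algebra_simps)
    qed
    have contA': "continuous_on UNIV (\<lambda>y. A (Complex x y))" and contB': "continuous_on UNIV (\<lambda>y. B (Complex x y))"
      by (rule continuous_on_compose2[OF contA contline], use line in blast)
         (rule continuous_on_compose2[OF contB contline], use line in blast)
    have contg': "continuous_on UNIV \<gamma>'"
      unfolding \<gamma>'_def by (intro continuous_intros contA' contB')
    define a where "a = (\<lambda>y. cmod (A (Complex x y)))"
    have a[measurable]: "a \<in> borel_measurable borel"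
      unfolding a_def using contA' by (intro borel_measurable_continuous_onI continuous_intros)
    have contgam: "continuous_on UNIV \<gamma>"
      using derg by (meson continuous_at_imp_continuous_on has_vector_derivative_continuous)
    then have gm[measurable]: "\<gamma> \<in> borel_measurable borel" by (rule borel_measurable_continuous_onI)
    define T where "T = {y \<in> {0..2*pi}. cmod (\<gamma> y) < 1 + 1/2}"
    have T[measurable]: "T \<in> sets borel" unfolding T_def by measurable
    have ga: "cmod (\<gamma>' y) \<le> 2 * a y" for y
    proof -
      have "cmod (\<gamma>' y) \<le> cmod (A (Complex x y)) + cmod (B (Complex x y))"
        unfolding \<gamma>'_def by (rule norm_triangle_le) (simp add: norm_mult)
      also have "\<dots> \<le> 2 * a y"
        using dilAB[OF line, of y] mult_right_mono[of k 1 "cmod (A (Complex x y))"] k by (simp add: a_def)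
      finally show ?thesis .
    qed
    have "ennreal (1/2) \<le> (\<integral>\<^sup>+y. ennreal (indicator T y * cmod (\<gamma>' y)) \<partial>lborel)"
      unfolding T_def
      by (rule length_in_disk_ge[where s = s and t = t])
         (use derg continuous_on_subset[OF contg' subset_UNIV] s t pq in \<open>auto simp: \<gamma>_def u_def\<close>)
    also have "\<dots> \<le> (\<integral>\<^sup>+y. ennreal (8 * pi * (indicator T y * (a y)\<^sup>2) + indicator {0..2*pi} y / (8 * pi)) \<partial>lborel)"
    proof (intro nn_integral_mono ennreal_leI)
      fix y
      \<comment> \<open>\<open>2 a \<le> 8 pi a\<^sup>2 + 1 / (8 pi)\<close> replaces Cauchy-Schwarz; the weight is chosen so that the
        constant term has integral \<open>1/4\<close> over the circle, half of the length available\<close>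
      have "0 \<le> (8 * pi * a y - 1)\<^sup>2 / (8 * pi)" by simp
      also have "\<dots> = 8 * pi * (a y)\<^sup>2 - 2 * a y + 1 / (8 * pi)"
        by (simp add: power2_eq_square field_simps)
      finally have "cmod (\<gamma>' y) \<le> 8 * pi * (a y)\<^sup>2 + 1 / (8 * pi)" using ga[of y] by simp
      then show "indicator T y * cmod (\<gamma>' y) \<le> 8 * pi * (indicator T y * (a y)\<^sup>2) + indicator {0..2*pi} y / (8 * pi)"
        by (auto simp: indicator_def T_def)
    qed
    also have "\<dots> = ennreal (8 * pi) * (\<integral>\<^sup>+y. ennreal (indicator T y * (a y)\<^sup>2) \<partial>lborel)
        + (\<integral>\<^sup>+y. ennreal (1 / (8 * pi)) * indicator {0..2*pi} y \<partial>lborel)"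
    proof -
      have "(\<integral>\<^sup>+y. ennreal (8 * pi * (indicator T y * (a y)\<^sup>2) + indicator {0..2*pi} y / (8 * pi)) \<partial>lborel)
          = (\<integral>\<^sup>+y. (ennreal (8 * pi) * ennreal (indicator T y * (a y)\<^sup>2))
              + ennreal (1 / (8 * pi)) * indicator {0..2*pi} y \<partial>lborel)"
        by (intro nn_integral_cong)
           (simp add: ennreal_mult ennreal_plus indicator_def)
      also have "\<dots> = (\<integral>\<^sup>+y. ennreal (8 * pi) * ennreal (indicator T y * (a y)\<^sup>2) \<partial>lborel)
          + (\<integral>\<^sup>+y. ennreal (1 / (8 * pi)) * indicator {0..2*pi} y \<partial>lborel)"
        by (rule nn_integral_add) auto
      also have "(\<integral>\<^sup>+y. ennreal (8 * pi) * ennreal (indicator T y * (a y)\<^sup>2) \<partial>lborel)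
          = ennreal (8 * pi) * (\<integral>\<^sup>+y. ennreal (indicator T y * (a y)\<^sup>2) \<partial>lborel)"
        by (rule nn_integral_cmult) auto
      finally show ?thesis .
    qed
    also have "(\<integral>\<^sup>+y. ennreal (1 / (8 * pi)) * indicator {0..2*pi} y \<partial>lborel) = ennreal (1/4)"
      by (subst nn_integral_cmult_indicator) (auto simp: ennreal_mult[symmetric])
    finally have half: "ennreal (1/2) \<le> ennreal (8 * pi) * (\<integral>\<^sup>+y. ennreal (indicator T y * (a y)\<^sup>2) \<partial>lborel) + ennreal (1/4)" .
    have "ennreal (1 / (32 * pi)) \<le> (\<integral>\<^sup>+y. ennreal (indicator T y * (a y)\<^sup>2) \<partial>lborel)"
    proof (cases "\<integral>\<^sup>+y. ennreal (indicator T y * (a y)\<^sup>2) \<partial>lborel")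
      case (real r)
      then have "ennreal (1/2) \<le> ennreal (8 * pi * r + 1/4)"
        using half by (simp add: ennreal_mult)
      then have "1/2 \<le> 8 * pi * r + 1/4" using real by (subst (asm) ennreal_le_iff) auto
      then show ?thesis using real by (simp add: field_simps)
    qed simp
    then have "ennreal (1 - k\<^sup>2) * ennreal (1 / (32 * pi)) \<le> ennreal (1 - k\<^sup>2) * (\<integral>\<^sup>+y. ennreal (indicator T y * (a y)\<^sup>2) \<partial>lborel)"
      by (rule mult_left_mono) simp
    also have "\<dots> = (\<integral>\<^sup>+y. ennreal ((1 - k\<^sup>2) * (indicator T y * (a y)\<^sup>2)) \<partial>lborel)"
      using k2 by (subst nn_integral_cmult[symmetric]) (simp_all add: ennreal_mult)
    also have "\<dots> \<le> (\<integral>\<^sup>+y. ennreal (indicator S (Complex x y)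
            * ((cmod (A (Complex x y)))\<^sup>2 - (cmod (B (Complex x y)))\<^sup>2)) \<partial>lborel)"
    proof (rule nn_integral_mono_AE)
      show "AE y in lborel. ennreal ((1 - k\<^sup>2) * (indicator T y * (a y)\<^sup>2)) \<le> ennreal (indicator S (Complex x y)
            * ((cmod (A (Complex x y)))\<^sup>2 - (cmod (B (Complex x y)))\<^sup>2))"
        using AE_lborel_singleton[of 0] AE_lborel_singleton[of "2 * pi"]
      proof eventually_elim
        case (elim y)
        show ?case
        proof (cases "y \<in> T")
          case True
          then have "Complex x y \<in> S" using elim x line by (auto simp: S_def T_def \<gamma>_def)
          then show ?thesis using True dil2[OF line, of y] by (simp add: a_def ennreal_leI)
        qed simp
      qed
    qed
    finally show ?thesis using k2 by (simp add: ennreal_mult[symmetric])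
  qed
  have "ennreal ((1 - k\<^sup>2) / (32 * pi) * M) = (\<integral>\<^sup>+x. ennreal ((1 - k\<^sup>2) / (32 * pi)) * indicator {- M<..<0} x \<partial>lborel)"
    using M k2 by (subst nn_integral_cmult_indicator) (auto simp: ennreal_mult[symmetric])
  also have "\<dots> \<le> (\<integral>\<^sup>+x. \<integral>\<^sup>+y. ennreal (indicator S (Complex x y)
            * ((cmod (A (Complex x y)))\<^sup>2 - (cmod (B (Complex x y)))\<^sup>2)) \<partial>lborel \<partial>lborel)"
  proof (rule nn_integral_mono)
    fix x
    show "ennreal ((1 - k\<^sup>2) / (32 * pi)) * indicator {- M<..<0} x \<le> (\<integral>\<^sup>+y. ennreal (indicator S (Complex x y)
            * ((cmod (A (Complex x y)))\<^sup>2 - (cmod (B (Complex x y)))\<^sup>2)) \<partial>lborel)"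
      using slice[of x] by (cases "x \<in> {- M<..<0}") auto
  qed
  also note area
  finally have "(1 - k\<^sup>2) / (32 * pi) * M \<le> 9"
    by (subst (asm) ennreal_le_iff) (simp_all add: power2_eq_square)
  then have "M \<le> 288 * pi / (1 - k\<^sup>2)"
    using k2 by (simp add: field_simps)
  then have "exp (- (288 * pi / (1 - k\<^sup>2))) \<le> exp (- M)" by simp
  also have "\<dots> = cmod z" using z0 by (simp add: M_def)
  finally show ?thesis .
qed

text \<open>Since \<open>Re F = Re (H + G)\<close>, a bound for the harmonic function \<open>F\<close> bounds the holomorphic function
  \<open>exp (H + G)\<close>, to which Cauchy's inequality applies; and \<open>|H' + G'| \<ge> (1 - k) |H'|\<close>.\<close>

lemma deriv_center_bounded:
  fixes H G :: "complex \<Rightarrow> complex"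
  defines "F \<equiv> \<lambda>z. H z + cnj (G z)"
  assumes hol: "H holomorphic_on \<D>" "G holomorphic_on \<D>" and inj: "inj_on F \<D>"
    and k: "0 \<le> k" "k < 1" and dil: "\<And>z. z \<in> \<D> \<Longrightarrow> cmod (deriv G z) \<le> k * cmod (deriv H z)"
    and F0: "F 0 = 0" and omit: "1 \<notin> F ` \<D>"
  shows "(1 - k) * exp (- (288 * pi / (1 - k\<^sup>2))) * cmod (deriv H 0) \<le> 2 * exp 1"
proof -
  define r where "r = exp (- (288 * pi / (1 - k\<^sup>2)))"
  have "k\<^sup>2 < 1" using k by (simp add: abs_square_less_1)
  then have r: "0 < r" "r \<le> 1" by (simp_all add: r_def)
  have small: "cmod (F z) < 1" if "cmod z < r" for z
    using near_center_bounded[OF hol inj[unfolded F_def] k dil F0[unfolded F_def] omit[unfolded F_def], of z]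
      that r unfolding F_def r_def by force
  define P where "P = (\<lambda>z. exp (H z + G z))"
  have holP: "P holomorphic_on \<D>"
    unfolding P_def by (intro holomorphic_intros hol)
  have Re: "Re (H z + G z) = Re (F z)" for z by (simp add: F_def)
  have P: "cmod (P z) \<le> exp 1" if "cmod z < r" for z
    using small[OF that] abs_Re_le_cmod[of "F z"] Re[of z] by (simp add: P_def)
  have "cmod ((deriv ^^ 1) P 0) \<le> fact 1 * exp 1 / (r / 2) ^ 1"
  proof (rule Cauchy_inequality)
    show "P holomorphic_on ball 0 (r / 2)" "continuous_on (cball 0 (r / 2)) P"
      using r holP by (auto intro!: holomorphic_on_imp_continuous_on elim!: holomorphic_on_subset)
  qed (use r P in auto)
  then have "r * cmod (deriv P 0) \<le> 2 * exp 1" using r by (simp add: field_simps)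
  moreover have "cmod (deriv P 0) = cmod (deriv H 0 + deriv G 0)"
  proof -
    have "(H has_field_derivative deriv H 0) (at 0)" "(G has_field_derivative deriv G 0) (at 0)"
      using hol by (auto intro!: holomorphic_derivI[of _ \<D>])
    then have "(P has_field_derivative exp (H 0 + G 0) * (deriv H 0 + deriv G 0)) (at 0)"
      unfolding P_def by (auto intro!: derivative_eq_intros)
    then show ?thesis
      using Re[of 0] F0 by (simp add: DERIV_imp_deriv norm_mult)
  qed
  moreover have "(1 - k) * cmod (deriv H 0) \<le> cmod (deriv H 0 + deriv G 0)"
    using dil[of 0] norm_diff_ineq[of "deriv H 0" "deriv G 0"] by (simp add: algebra_simps)
  ultimately have *: "(1 - k) * cmod (deriv H 0) \<le> cmod (deriv P 0)" "r * cmod (deriv P 0) \<le> 2 * exp 1"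
    by simp_all
  have "r * ((1 - k) * cmod (deriv H 0)) \<le> 2 * exp 1"
    using mult_left_mono[OF *(1) less_imp_le[OF r(1)]] *(2) by (rule order_trans)
  then show ?thesis by (simp add: r_def mult_ac)
qed

text \<open>A Koebe-type distortion theorem: rescale the disk of radius \<open>1 - |z|\<close> around \<open>z\<close> to the unit disk,
  and the image so that \<open>F z\<close> and the omitted value \<open>w\<close> become \<open>0\<close> and \<open>1\<close>. Division by \<open>a = w - F z\<close>
  keeps a map harmonic with the same bound on its dilatation, as it divides \<open>h\<close> by \<open>a\<close> and \<open>g\<close> by
  \<open>cnj a\<close>.\<close>

lemma harmonic_qc_Koebe:
  fixes k :: real
  assumes k: "0 \<le> k" "k < 1"
  obtains c where "0 < c"
    "\<And>h g z w. h holomorphic_on \<D> \<Longrightarrow> g holomorphic_on \<D> \<Longrightarrow> inj_on (\<lambda>z. h z + cnj (g z)) \<D> \<Longrightarrow>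
      (\<forall>z\<in>\<D>. cmod (deriv g z) \<le> k * cmod (deriv h z)) \<Longrightarrow> z \<in> \<D> \<Longrightarrow>
      w \<notin> (\<lambda>z. h z + cnj (g z)) ` \<D> \<Longrightarrow>
      c * ((1 - cmod z) * cmod (deriv h z)) \<le> cmod (w - (h z + cnj (g z)))"
proof
  define c where "c = (1 - k) * exp (- (288 * pi / (1 - k\<^sup>2))) / (2 * exp 1)"
  show "0 < c" using k by (simp add: c_def)
  fix h g z w
  assume h: "h holomorphic_on \<D>" and g: "g holomorphic_on \<D>" and inj: "inj_on (\<lambda>z. h z + cnj (g z)) \<D>"
    and dil: "\<forall>z\<in>\<D>. cmod (deriv g z) \<le> k * cmod (deriv h z)" and z: "z \<in> \<D>"
    and w: "w \<notin> (\<lambda>z. h z + cnj (g z)) ` \<D>"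
  define a where "a = w - (h z + cnj (g z))"
  have a: "a \<noteq> 0" using w z by (auto simp: a_def)
  define s where "s = 1 - cmod z"
  have s: "0 < s" using z by (simp add: s_def)
  define T where "T = (\<lambda>\<zeta>. z + of_real s * \<zeta>)"
  have T: "T \<zeta> \<in> \<D>" if "\<zeta> \<in> \<D>" for \<zeta>
  proof -
    have "cmod (T \<zeta>) \<le> cmod z + s * cmod \<zeta>"
      unfolding T_def using s by (intro norm_triangle_le) (simp add: norm_mult)
    also have "\<dots> < cmod z + s * 1" using s that by (intro add_strict_left_mono mult_strict_left_mono) auto
    finally show ?thesis by (simp add: s_def)
  qed
  define H where "H = (\<lambda>\<zeta>. (h (T \<zeta>) - h z) / a)"
  define G where "G = (\<lambda>\<zeta>. (g (T \<zeta>) - g z) / cnj a)"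
  have dT: "(T has_field_derivative of_real s) (at \<zeta>)" for \<zeta>
    unfolding T_def by (auto intro!: derivative_eq_intros)
  have dH: "(H has_field_derivative deriv h (T \<zeta>) * of_real s / a) (at \<zeta>)"
    and dG: "(G has_field_derivative deriv g (T \<zeta>) * of_real s / cnj a) (at \<zeta>)" if "\<zeta> \<in> \<D>" for \<zeta>
  proof -
    have "(h has_field_derivative deriv h (T \<zeta>)) (at (T \<zeta>))" "(g has_field_derivative deriv g (T \<zeta>)) (at (T \<zeta>))"
      using h g T[OF that] by (auto intro!: holomorphic_derivI[of _ \<D>])
    from this[THEN DERIV_chain2[OF _ dT]]
    show "(H has_field_derivative deriv h (T \<zeta>) * of_real s / a) (at \<zeta>)"
      "(G has_field_derivative deriv g (T \<zeta>) * of_real s / cnj a) (at \<zeta>)"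
      unfolding H_def G_def using a by (auto intro!: derivative_eq_intros)
  qed
  have F: "H \<zeta> + cnj (G \<zeta>) = ((h (T \<zeta>) + cnj (g (T \<zeta>))) - (h z + cnj (g z))) / a" for \<zeta>
    by (simp add: H_def G_def diff_divide_distrib add_divide_distrib)
  have "(1 - k) * exp (- (288 * pi / (1 - k\<^sup>2))) * cmod (deriv H 0) \<le> 2 * exp 1"
  proof (rule deriv_center_bounded[where G = G])
    show "H holomorphic_on \<D>" "G holomorphic_on \<D>"
      using dH dG by (meson holomorphic_on_open open_ball)+
    show "inj_on (\<lambda>\<zeta>. H \<zeta> + cnj (G \<zeta>)) \<D>"
    proof (rule inj_onI)
      fix x y assume xy: "x \<in> \<D>" "y \<in> \<D>" "H x + cnj (G x) = H y + cnj (G y)"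
      then have "h (T x) + cnj (g (T x)) = h (T y) + cnj (g (T y))" using a by (simp add: F)
      then have "T x = T y" using inj T xy by (meson inj_onD)
      then show "x = y" using s by (simp add: T_def)
    qed
    show "cmod (deriv G \<zeta>) \<le> k * cmod (deriv H \<zeta>)" if "\<zeta> \<in> \<D>" for \<zeta>
    proof -
      have "cmod (deriv g (T \<zeta>)) * (s / cmod a) \<le> k * cmod (deriv h (T \<zeta>)) * (s / cmod a)"
        using dil T[OF that] s by (intro mult_right_mono) auto
      then show ?thesis
        using s by (simp add: DERIV_imp_deriv[OF dH[OF that]] DERIV_imp_deriv[OF dG[OF that]] norm_mult norm_divide)
    qed
    show "H 0 + cnj (G 0) = 0" by (simp add: F T_def)
    show "1 \<notin> (\<lambda>\<zeta>. H \<zeta> + cnj (G \<zeta>)) ` \<D>"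
    proof
      assume "1 \<in> (\<lambda>\<zeta>. H \<zeta> + cnj (G \<zeta>)) ` \<D>"
      then obtain \<zeta> where \<zeta>: "\<zeta> \<in> \<D>" "H \<zeta> + cnj (G \<zeta>) = 1" by force
      then have "h (T \<zeta>) + cnj (g (T \<zeta>)) = w" using a by (simp add: F field_simps) (simp add: a_def)
      then show False using w T[OF \<zeta>(1)] by blast
    qed
  qed (use k in auto)
  then have "c * cmod (deriv H 0) \<le> 1" by (simp add: c_def field_simps)
  moreover have "cmod (deriv H 0) = (1 - cmod z) * cmod (deriv h z) / cmod a"
  proof -
    have "deriv H 0 = deriv h z * of_real s / a"
      using DERIV_imp_deriv[OF dH[of 0]] by (simp add: T_def)
    then have "cmod (deriv H 0) = s * cmod (deriv h z) / cmod a"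
      using s by (simp add: norm_mult norm_divide)
    then show ?thesis by (simp add: s_def)
  qed
  ultimately show "c * ((1 - cmod z) * cmod (deriv h z)) \<le> cmod (w - (h z + cnj (g z)))"
    using a by (simp add: a_def[symmetric] divide_le_eq)
qed


section \<open>Growth along radii\<close>

text \<open>The increments of \<open>\<Phi>\<close> over the intervals of a division telescope.\<close>

lemma curve_length_le:
  assumes ab: "a \<le> b"
    and bound: "\<And>x y. a \<le> x \<Longrightarrow> x \<le> y \<Longrightarrow> y \<le> b \<Longrightarrow> dist (\<gamma> x) (\<gamma> y) \<le> \<Phi> y - \<Phi> x"
  shows "curve_length \<gamma> a b \<le> ennreal (\<Phi> b - \<Phi> a)"
  unfolding curve_length_def
proof (rule SUP_least)
  fix d assume "d \<in> {d. d division_of {a..b}}"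
  then have d: "d division_of {a..b}" by simp
  have iv: "\<exists>u v. I = {u..v} \<and> u \<le> v \<and> a \<le> u \<and> v \<le> b" if I: "I \<in> d" for I
  proof -
    from division_ofD(2-4)[OF d I] obtain u v where "I = {u..v}" "I \<noteq> {}" "I \<subseteq> {a..b}" by auto
    then show ?thesis by (metis atLeastatMost_empty_iff atLeastatMost_subset_iff)
  qed
  have "(\<Sum>I\<in>d. ennreal (dist (\<gamma> (Inf I)) (\<gamma> (Sup I)))) = ennreal (\<Sum>I\<in>d. dist (\<gamma> (Inf I)) (\<gamma> (Sup I)))"
    by simp
  also have "\<dots> \<le> ennreal (\<Sum>I\<in>d. \<Phi> (Sup I) - \<Phi> (Inf I))"
    using iv bound by (intro ennreal_leI sum_mono) fastforce
  also have "(\<Sum>I\<in>d. \<Phi> (Sup I) - \<Phi> (Inf I)) = (\<Sum>(x,I)\<in>(\<lambda>I. (Inf I, I)) ` d. \<Phi> (Sup I) - \<Phi> (Inf I))"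
    by (subst sum.reindex) (auto simp: inj_on_def)
  also have "\<dots> = \<Phi> b - \<Phi> a"
  proof (rule additive_tagged_division_1[OF ab tagged_division_ofI])
    show "finite ((\<lambda>I. (Inf I, I)) ` d)" using d by auto
    show "x \<in> K" "K \<subseteq> {a..b}" "\<exists>a b. K = cbox a b" if "(x, K) \<in> (\<lambda>I. (Inf I, I)) ` d" for x K
      using that iv[of K] by auto
    show "interior K1 \<inter> interior K2 = {}"
      if "(x1, K1) \<in> (\<lambda>I. (Inf I, I)) ` d" "(x2, K2) \<in> (\<lambda>I. (Inf I, I)) ` d" "(x1, K1) \<noteq> (x2, K2)" for x1 K1 x2 K2
      using that division_ofD(5)[OF d] by auto
    show "\<Union>{K. \<exists>x. (x, K) \<in> (\<lambda>I. (Inf I, I)) ` d} = {a..b}"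
    proof -
      have "{K. \<exists>x. (x, K) \<in> (\<lambda>I. (Inf I, I)) ` d} = d" by (auto simp: image_iff)
      then show ?thesis using division_ofD(6)[OF d] by simp
    qed
  qed
  finally show "(\<Sum>I\<in>d. ennreal (dist (\<gamma> (Inf I)) (\<gamma> (Sup I)))) \<le> ennreal (\<Phi> b - \<Phi> a)" .
qed

text \<open>Here \<open>N\<close> stands for the Jacobian or for \<open>|h'|\<^sup>2\<close>, and \<open>p\<close> for \<open>h'\<close>; \<open>N' z\<close> is \<open>|z|\<close> times the radial
  derivative of \<open>N\<close>. The differential inequality says that \<open>N\<close> grows along a radius not faster than a
  solution of \<open>y' = 2 * \<beta> * y / (s * (1 - s\<^sup>2))\<close>. As \<open>s * (1 + s)\<close> tends to \<open>2\<close> and \<open>\<beta> < 2\<close>, there is \<open>a < 1\<close>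
  such that \<open>N(s\<zeta>) (1 - s) powr (2 * a)\<close> decreases for \<open>s\<close> close to \<open>1\<close>. On the remaining compact disk
  \<open>|p|\<close> lies between positive constants.\<close>

lemma radial_growth:
  fixes p :: "complex \<Rightarrow> complex" and N :: "complex \<Rightarrow> real"
  assumes p: "continuous_on \<D> p" "\<And>z. z \<in> \<D> \<Longrightarrow> p z \<noteq> 0"
    and m: "0 < m" "\<And>z. z \<in> \<D> \<Longrightarrow> m * (cmod (p z))\<^sup>2 \<le> N z" "\<And>z. z \<in> \<D> \<Longrightarrow> N z \<le> (cmod (p z))\<^sup>2"
    and \<beta>: "0 \<le> \<beta>" "\<beta> < 2" and r0: "r0 < 1"
    and der: "\<And>z. r0 < cmod z \<Longrightarrow> cmod z < 1 \<Longrightarrow>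
       \<exists>N'. (N has_derivative N') (at z) \<and> N' z \<le> 2 * \<beta> * N z / (1 - (cmod z)\<^sup>2)"
  obtains a C where "0 \<le> a" "a < 1" "0 < C"
    "\<And>\<zeta> r \<rho>. cmod \<zeta> = 1 \<Longrightarrow> 0 \<le> r \<Longrightarrow> r \<le> \<rho> \<Longrightarrow> \<rho> < 1 \<Longrightarrow>
       cmod (p (of_real \<rho> * \<zeta>)) * (1 - \<rho>) powr a \<le> C * (cmod (p (of_real r * \<zeta>)) * (1 - r) powr a)"
proof -
  define b where "b = \<beta> / 2"
  \<comment> \<open>the square of \<open>(b + 1) / 2\<close> exceeds \<open>b\<close>, so \<open>b / r1\<^sup>2 < 1\<close>\<close>
  define r1 where "r1 = max r0 ((b + 1) / 2)"
  have b: "0 \<le> b" "b < 1" using \<beta> by (auto simp: b_def)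
  have r1: "0 < r1" "r1 < 1" "r0 \<le> r1" using b r0 by (auto simp: r1_def less_max_iff_disj)
  have "b < ((b + 1) / 2)\<^sup>2"
  proof -
    have "0 < (1 - b)\<^sup>2" using b by simp
    then show ?thesis by (simp add: power2_eq_square field_simps)
  qed
  also have "\<dots> \<le> r1\<^sup>2" using b by (intro power_mono) (auto simp: r1_def)
  finally have br1: "b < r1\<^sup>2" .
  define a where "a = b / r1\<^sup>2"
  have a: "0 \<le> a" "a < 1" using b r1 br1 by (auto simp: a_def)
  \<comment> \<open>strictly above \<open>r1\<close>, since the differential inequality is available only on an open range\<close>
  define r2 where "r2 = (1 + r1) / 2"
  have r2: "r1 < r2" "r2 < 1" "0 < r2" using r1 by (auto simp: r2_def)
  have decreasing: "N (of_real \<rho> * \<zeta>) * (1 - \<rho>) powr (2 * a) \<le> N (of_real r * \<zeta>) * (1 - r) powr (2 * a)"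
    if \<zeta>: "cmod \<zeta> = 1" and r: "r2 \<le> r" "r \<le> \<rho>" "\<rho> < 1" for \<zeta> r \<rho>
  proof (rule DERIV_nonpos_imp_nonincreasing[OF r(2)])
    fix s assume "r \<le> s" "s \<le> \<rho>"
    then have s: "r1 < s" "s < 1" "0 < s" using r r1 r2 by auto
    define z where "z = of_real s * \<zeta>"
    have z: "cmod z = s" using s \<zeta> by (simp add: z_def norm_mult)
    obtain N' where N': "(N has_derivative N') (at z)" "N' z \<le> 2 * \<beta> * N z / (1 - s\<^sup>2)"
      using der[of z] s r1 by (auto simp: z)
    have lin: "linear N'" using N'(1) by (rule has_derivative_linear)
    have zs: "z = s *\<^sub>R \<zeta>" by (simp add: z_def scaleR_conv_of_real)
    have N'z: "N' z = s * N' \<zeta>" using linear_scale[OF lin, of s \<zeta>] zs by simp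
    have "0 \<le> m * (cmod (p z))\<^sup>2" using m(1) by simp
    also have "\<dots> \<le> N z" using m(2)[of z] z s by simp
    finally have N0: "0 \<le> N z" .
    have line: "((\<lambda>s. of_real s * \<zeta>) has_derivative (\<lambda>e. e *\<^sub>R \<zeta>)) (at s)"
      by (auto intro!: derivative_eq_intros simp: scaleR_conv_of_real)
    from diff_chain_at[OF line, of N N'] N'(1)
    have "((\<lambda>s. N (of_real s * \<zeta>)) has_derivative (\<lambda>e. N' (e *\<^sub>R \<zeta>))) (at s)"
      by (simp add: o_def z_def)
    moreover have "(\<lambda>e. N' (e *\<^sub>R \<zeta>)) = (*) (N' \<zeta>)"
      by (auto simp: linear_scale[OF lin])
    ultimately have dN: "((\<lambda>s. N (of_real s * \<zeta>)) has_real_derivative N' \<zeta>) (at s)"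
      by (simp add: has_field_derivative_def)
    have dpow: "((\<lambda>s. (1 - s) powr (2 * a)) has_real_derivative - (2 * a) * (1 - s) powr (2 * a - 1)) (at s)"
      using s by (auto intro!: derivative_eq_intros simp: powr_diff)
    have N'le: "N' \<zeta> \<le> 2 * a * N z / (1 - s)"
    proof -
      have "N' \<zeta> \<le> 2 * \<beta> * N z / (1 - s\<^sup>2) / s"
        using N'(2) unfolding N'z by (subst pos_le_divide_eq[OF s(3)]) (simp only: mult.commute[of s])
      also have "\<dots> = (2 * N z / (1 - s)) * (\<beta> / (s * (1 + s)))"
      proof -
        have "1 - s\<^sup>2 = (1 - s) * (1 + s)" by (simp add: power2_eq_square algebra_simps)
        then show ?thesis using s by (simp add: mult_ac)
      qed
      also have "\<dots> \<le> (2 * N z / (1 - s)) * a"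
      proof (rule mult_left_mono)
        have "2 * r1\<^sup>2 \<le> 2 * s\<^sup>2" using s r1 by (simp add: power_mono)
        also have "\<dots> \<le> s * (1 + s)" using s by (simp add: power2_eq_square algebra_simps)
        finally have "\<beta> / (s * (1 + s)) \<le> \<beta> / (2 * r1\<^sup>2)"
          using \<beta> r1 s by (intro divide_left_mono) auto
        then show "\<beta> / (s * (1 + s)) \<le> a" by (simp add: a_def b_def)
      qed (use N0 s in auto)
      finally show ?thesis by (simp add: mult_ac)
    qed
    have "N' \<zeta> * (1 - s) powr (2 * a) + (- (2 * a) * (1 - s) powr (2 * a - 1)) * N z \<le> 0"
    proof -
      have "N' \<zeta> * (1 - s) powr (2 * a) \<le> 2 * a * N z / (1 - s) * (1 - s) powr (2 * a)"
        using N'le by (intro mult_right_mono) auto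
      also have "\<dots> = 2 * a * (1 - s) powr (2 * a - 1) * N z"
        using s by (simp add: powr_diff)
      finally show ?thesis by simp
    qed
    then show "\<exists>y. ((\<lambda>s. N (of_real s * \<zeta>) * (1 - s) powr (2 * a)) has_real_derivative y) (at s) \<and> y \<le> 0"
      using DERIV_mult[OF dN dpow] unfolding z_def by blast
  qed
  define c1 where "c1 = 1 / sqrt m"
  have c1: "0 < c1" using m(1) by (simp add: c1_def)
  have outer: "cmod (p (of_real \<rho> * \<zeta>)) * (1 - \<rho>) powr a \<le> c1 * (cmod (p (of_real r * \<zeta>)) * (1 - r) powr a)"
    if \<zeta>: "cmod \<zeta> = 1" and r: "r2 \<le> r" "r \<le> \<rho>" "\<rho> < 1" for \<zeta> r \<rho>
  proof (rule power2_le_imp_le)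
    have D: "of_real \<rho> * \<zeta> \<in> \<D>" "of_real r * \<zeta> \<in> \<D>" using \<zeta> r r2 by (auto simp: norm_mult)
    have sq: "(x powr a)\<^sup>2 = x powr (2 * a)" for x :: real
      by (simp add: power2_eq_square powr_add[symmetric])
    have "m * ((cmod (p (of_real \<rho> * \<zeta>)))\<^sup>2 * (1 - \<rho>) powr (2 * a)) \<le> N (of_real \<rho> * \<zeta>) * (1 - \<rho>) powr (2 * a)"
      using mult_right_mono[OF m(2)[OF D(1)]] by (simp add: mult.assoc)
    also have "\<dots> \<le> N (of_real r * \<zeta>) * (1 - r) powr (2 * a)" by (rule decreasing[OF \<zeta> r])
    also have "\<dots> \<le> (cmod (p (of_real r * \<zeta>)))\<^sup>2 * (1 - r) powr (2 * a)"
      by (intro mult_right_mono m(3) D) auto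
    finally show "(cmod (p (of_real \<rho> * \<zeta>)) * (1 - \<rho>) powr a)\<^sup>2 \<le> (c1 * (cmod (p (of_real r * \<zeta>)) * (1 - r) powr a))\<^sup>2"
      using m(1) by (simp add: power_mult_distrib sq c1_def power_divide field_simps)
  qed (use c1 in auto)
  have comp: "compact (cball 0 r2 :: complex set)" "cball 0 r2 \<noteq> ({} :: complex set)" "cball 0 r2 \<subseteq> \<D>"
    using r2 by auto
  have cont: "continuous_on (cball 0 r2) (\<lambda>z. cmod (p z))"
    using p(1) comp(3) by (intro continuous_intros) (rule continuous_on_subset)
  obtain u where u: "u \<in> cball 0 r2" "\<And>z. z \<in> cball 0 r2 \<Longrightarrow> cmod (p u) \<le> cmod (p z)"
    using continuous_attains_inf[OF comp(1,2) cont] by blast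
  obtain v where v: "v \<in> cball 0 r2" "\<And>z. z \<in> cball 0 r2 \<Longrightarrow> cmod (p z) \<le> cmod (p v)"
    using continuous_attains_sup[OF comp(1,2) cont] by blast
  have pu: "0 < cmod (p u)" using p(2) u(1) comp(3) by auto
  have pv: "0 < cmod (p v)" using p(2) v(1) comp(3) by auto
  define c2 where "c2 = cmod (p v) / (cmod (p u) * (1 - r2) powr a)"
  have c2: "0 < c2" using pu pv r2 by (simp add: c2_def)
  have inner: "cmod (p (of_real \<rho> * \<zeta>)) * (1 - \<rho>) powr a \<le> c2 * (cmod (p (of_real r * \<zeta>)) * (1 - r) powr a)"
    if \<zeta>: "cmod \<zeta> = 1" and r: "0 \<le> r" "r \<le> \<rho>" "\<rho> \<le> r2" for \<zeta> r \<rho>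
  proof -
    have D: "of_real \<rho> * \<zeta> \<in> cball 0 r2" "of_real r * \<zeta> \<in> cball 0 r2" using \<zeta> r by (auto simp: norm_mult)
    have "(1 - \<rho>) powr a \<le> 1 powr a" using r r2 a by (intro powr_mono2) auto
    then have "cmod (p (of_real \<rho> * \<zeta>)) * (1 - \<rho>) powr a \<le> cmod (p v) * 1"
      using v(2)[OF D(1)] by (intro mult_mono) auto
    also have "\<dots> = c2 * (cmod (p u) * (1 - r2) powr a)" using pu r2 by (simp add: c2_def)
    also have "\<dots> \<le> c2 * (cmod (p (of_real r * \<zeta>)) * (1 - r) powr a)"
      using c2 u(2)[OF D(2)] r r2 a by (intro mult_left_mono mult_mono powr_mono2) auto
    finally show ?thesis .
  qed
  define C where "C = max (max c1 c2) (c1 * c2)"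
  have C: "c1 \<le> C" "c2 \<le> C" "c1 * c2 \<le> C" "0 < C" using c1 by (auto simp: C_def)
  show thesis
  proof (rule that[OF a C(4)])
    fix \<zeta> :: complex and r \<rho> :: real
    assume \<zeta>: "cmod \<zeta> = 1" and r: "0 \<le> r" "r \<le> \<rho>" "\<rho> < 1"
    let ?q = "\<lambda>s. cmod (p (of_real s * \<zeta>)) * (1 - s) powr a"
    have q0: "0 \<le> ?q s" for s by simp
    consider "r2 \<le> r" | "\<rho> \<le> r2" | "r \<le> r2" "r2 \<le> \<rho>" by linarith
    then show "?q \<rho> \<le> C * ?q r"
    proof cases
      case 1
      then show ?thesis using outer[OF \<zeta> 1 r(2,3)] mult_right_mono[OF C(1) q0[of r]] by linarith
    next
      case 2
      then show ?thesis using inner[OF \<zeta> r(1,2) 2] mult_right_mono[OF C(2) q0[of r]] by linarith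
    next
      case 3
      have "?q \<rho> \<le> c1 * ?q r2" using outer[OF \<zeta> _ 3(2) r(3)] by simp
      also have "\<dots> \<le> c1 * (c2 * ?q r)" using inner[OF \<zeta> r(1) 3(1)] c1 by (intro mult_left_mono) auto
      finally show ?thesis using mult_right_mono[OF C(3) q0[of r]] by (simp add: mult.assoc)
    qed
  qed
qed


section \<open>Radial John disks\<close>

text \<open>Let \<open>W\<close> be the primitive of \<open>(1 - s) powr (- a)\<close> that vanishes at \<open>1\<close>. By the growth bound, \<open>B \<zeta> r * W\<close>
  majorizes the length of \<open>s \<mapsto> f(s\<zeta>)\<close> beyond \<open>r\<close>, so the total length up to the boundary is at most
  \<open>- B \<zeta> r * W r\<close>, a multiple of \<open>(1 - r) |h'(r\<zeta>)|\<close>. The Koebe-type estimate turns this quantity into the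
  distance to the frontier. The case \<open>r = 0\<close> shows that the image is bounded.\<close>

lemma radial_John_disk_of_growth:
  fixes f h g :: "complex \<Rightarrow> complex"
  assumes rep: "harmonic_repr f h g" and inj: "inj_on f \<D>"
    and k: "0 \<le> k" "k < 1" and dil: "\<And>z. z \<in> \<D> \<Longrightarrow> cmod (deriv g z) \<le> k * cmod (deriv h z)"
    and a: "0 \<le> a" "a < 1" and C: "0 < C"
    and growth: "\<And>\<zeta> r \<rho>. cmod \<zeta> = 1 \<Longrightarrow> 0 \<le> r \<Longrightarrow> r \<le> \<rho> \<Longrightarrow> \<rho> < 1 \<Longrightarrow>
       cmod (deriv h (of_real \<rho> * \<zeta>)) * (1 - \<rho>) powr a \<le> C * (cmod (deriv h (of_real r * \<zeta>)) * (1 - r) powr a)"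
  shows "radial_John_disk f (f ` \<D>)"
proof -
  have h: "h holomorphic_on \<D>" and g: "g holomorphic_on \<D>" and f: "\<And>z. z \<in> \<D> \<Longrightarrow> f z = h z + cnj (g z)"
    using rep by (auto simp: harmonic_repr_def)
  have derf: "(f has_derivative (\<lambda>e. deriv h z * e + cnj (deriv g z * e))) (at z)" if "z \<in> \<D>" for z
    using harmonic_repr_has_derivative[OF rep that] .
  have contf: "continuous_on \<D> f"
    using derf by (meson continuous_at_imp_continuous_on has_derivative_continuous)
  have openf: "open (f ` \<D>)"
    by (rule invariance_of_domain[OF contf open_ball inj])
  have "f ` \<D> homeomorphic \<D>"
    using invariance_of_domain_homeomorphic[OF open_ball contf _ inj] homeomorphic_sym by auto
  then have simply: "simply_connected (f ` \<D>)"
    using homeomorphic_simply_connected_eq convex_imp_simply_connected convex_ball by blast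

  define W where "W = (\<lambda>s. - ((1 - s) powr (1 - a) / (1 - a)))"
  define B where "B = (\<lambda>\<zeta> r. 2 * C * (cmod (deriv h (of_real r * \<zeta>)) * (1 - r) powr a))"
  have B0: "0 \<le> B \<zeta> r" for \<zeta> r using C by (simp add: B_def)
  have dist: "dist (f (of_real t * \<zeta>)) (f (of_real s * \<zeta>)) \<le> B \<zeta> r * W t - B \<zeta> r * W s"
    if \<zeta>: "cmod \<zeta> = 1" and r: "0 \<le> r" "r \<le> s" "s \<le> t" "t < 1" for \<zeta> r s t
  proof (cases "s = t")
    case False
    then have st: "s < t" using r by simp
    have D: "of_real x * \<zeta> \<in> \<D>" if "s \<le> x" "x \<le> t" for x using that r \<zeta> by (simp add: norm_mult)
    have "norm (f (of_real t * \<zeta>) - f (of_real s * \<zeta>)) \<le> B \<zeta> r * W t - B \<zeta> r * W s"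
    proof (rule differentiable_bound_general[OF st])
      show "continuous_on {s..t} (\<lambda>x. f (of_real x * \<zeta>))"
        by (rule continuous_on_compose2[OF contf]) (use D in \<open>auto intro!: continuous_intros\<close>)
      show "continuous_on {s..t} (\<lambda>x. B \<zeta> r * W x)"
        unfolding W_def using r a by (auto intro!: continuous_intros)
      fix x assume x: "s < x" "x < t"
      have "((\<lambda>x. of_real x * \<zeta>) has_derivative (\<lambda>e. of_real e * \<zeta>)) (at x)"
        by (auto intro!: derivative_eq_intros)
      from diff_chain_at[OF this derf[OF D]] x
      have "((\<lambda>x. f (of_real x * \<zeta>)) has_derivative
          (\<lambda>e. deriv h (of_real x * \<zeta>) * (of_real e * \<zeta>) + cnj (deriv g (of_real x * \<zeta>) * (of_real e * \<zeta>)))) (at x)"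
        by (simp add: o_def)
      then show "((\<lambda>x. f (of_real x * \<zeta>)) has_vector_derivative
          (deriv h (of_real x * \<zeta>) * \<zeta> + cnj (deriv g (of_real x * \<zeta>) * \<zeta>))) (at x)"
        by (simp add: has_vector_derivative_def scaleR_conv_of_real algebra_simps)
      have "((\<lambda>x. B \<zeta> r * W x) has_real_derivative B \<zeta> r * (1 - x) powr (- a)) (at x)"
        unfolding W_def using x r a by (auto intro!: derivative_eq_intros)
      then show "((\<lambda>x. B \<zeta> r * W x) has_vector_derivative B \<zeta> r * (1 - x) powr (- a)) (at x)"
        by (simp add: has_real_derivative_iff_has_vector_derivative)
      have "norm (deriv h (of_real x * \<zeta>) * \<zeta> + cnj (deriv g (of_real x * \<zeta>) * \<zeta>))
          \<le> cmod (deriv h (of_real x * \<zeta>)) + cmod (deriv g (of_real x * \<zeta>))"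
        by (rule norm_triangle_le) (simp add: norm_mult \<zeta>)
      also have "\<dots> \<le> 2 * cmod (deriv h (of_real x * \<zeta>))"
        using dil[OF D[of x]] x mult_right_mono[of k 1 "cmod (deriv h (of_real x * \<zeta>))"] k by simp
      also have "\<dots> \<le> B \<zeta> r * (1 - x) powr (- a)"
      proof -
        have p: "0 < (1 - x) powr a" using x r by simp
        have "2 * (cmod (deriv h (of_real x * \<zeta>)) * (1 - x) powr a) \<le> B \<zeta> r"
          using growth[OF \<zeta> r(1), of x] x r by (simp add: B_def)
        then show ?thesis using p by (simp add: powr_minus divide_inverse[symmetric] pos_le_divide_eq)
      qed
      finally show "norm (deriv h (of_real x * \<zeta>) * \<zeta> + cnj (deriv g (of_real x * \<zeta>) * \<zeta>))
          \<le> B \<zeta> r * (1 - x) powr (- a)" .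
    qed
    then show ?thesis by (simp add: dist_norm)
  qed simp
  have W: "W x \<le> 0" for x using a by (simp add: W_def)
  have BW: "- (B \<zeta> r * W r) = 2 * C / (1 - a) * ((1 - r) * cmod (deriv h (of_real r * \<zeta>)))" if "r < 1" for \<zeta> r
  proof -
    have "- (B \<zeta> r * W r) = 2 * C / (1 - a) * (((1 - r) powr a * (1 - r) powr (1 - a)) * cmod (deriv h (of_real r * \<zeta>)))"
      by (simp add: B_def W_def)
    also have "(1 - r) powr a * (1 - r) powr (1 - a) = 1 - r" using that by (simp add: powr_add[symmetric])
    finally show ?thesis .
  qed

  have polar: "\<exists>\<zeta>. cmod \<zeta> = 1 \<and> z = of_real (cmod z) * \<zeta>" for z
  proof (cases "z = 0")
    case True
    then show ?thesis by (intro exI[of _ 1]) simp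
  next
    case False
    then show ?thesis by (intro exI[of _ "z / of_real (cmod z)"]) (simp add: norm_divide)
  qed
  have bounded: "bounded (f ` \<D>)"
    unfolding bounded_def
  proof (intro exI[of _ "f 0"] exI[of _ "2 * C / (1 - a) * cmod (deriv h 0)"] ballI)
    fix w assume "w \<in> f ` \<D>"
    then obtain z where z: "z \<in> \<D>" "w = f z" by blast
    obtain \<zeta> where \<zeta>: "cmod \<zeta> = 1" "z = of_real (cmod z) * \<zeta>"
      using polar by blast
    have "dist w (f 0) \<le> B \<zeta> 0 * W (cmod z) - B \<zeta> 0 * W 0"
      using dist[OF \<zeta>(1), of 0 0 "cmod z"] z \<zeta>(2)[symmetric] by simp
    also have "\<dots> \<le> - (B \<zeta> 0 * W 0)" using mult_nonneg_nonpos[OF B0 W] by simp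
    finally show "dist (f 0) w \<le> 2 * C / (1 - a) * cmod (deriv h 0)"
      using BW[of 0 \<zeta>] by (simp add: dist_commute)
  qed
  obtain c where c: "0 < c"
    and Koebe: "\<And>z w. z \<in> \<D> \<Longrightarrow> w \<notin> f ` \<D> \<Longrightarrow> c * ((1 - cmod z) * cmod (deriv h z)) \<le> cmod (w - f z)"
  proof -
    obtain c where c: "0 < c"
      "\<And>h g z w. h holomorphic_on \<D> \<Longrightarrow> g holomorphic_on \<D> \<Longrightarrow> inj_on (\<lambda>z. h z + cnj (g z)) \<D> \<Longrightarrow>
        (\<forall>z\<in>\<D>. cmod (deriv g z) \<le> k * cmod (deriv h z)) \<Longrightarrow> z \<in> \<D> \<Longrightarrow>
        w \<notin> (\<lambda>z. h z + cnj (g z)) ` \<D> \<Longrightarrow>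
        c * ((1 - cmod z) * cmod (deriv h z)) \<le> cmod (w - (h z + cnj (g z)))"
      using harmonic_qc_Koebe[OF k] by blast
    have inj': "inj_on (\<lambda>z. h z + cnj (g z)) \<D>"
      using inj by (subst inj_on_cong[of _ _ f]) (auto simp: f)
    have im: "(\<lambda>z. h z + cnj (g z)) ` \<D> = f ` \<D>"
      by (intro image_cong) (auto simp: f)
    show thesis
    proof (rule that[OF c(1)])
      fix z w assume z: "z \<in> \<D>" and w: "w \<notin> f ` \<D>"
      show "c * ((1 - cmod z) * cmod (deriv h z)) \<le> cmod (w - f z)"
        using c(2)[OF h g inj' _ z] dil w by (simp only: im f[OF z]) blast
    qed
  qed
  have front: "frontier (f ` \<D>) \<noteq> {}"
    using bounded by (simp add: frontier_eq_empty) (metis not_bounded_UNIV)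
  have Koebe': "c * ((1 - cmod z) * cmod (deriv h z)) \<le> infdist (f z) (frontier (f ` \<D>))" if "z \<in> \<D>" for z
    unfolding infdist_notempty[OF front]
  proof (rule cINF_greatest[OF front])
    fix w assume "w \<in> frontier (f ` \<D>)"
    then have "w \<notin> f ` \<D>" using openf by (auto simp: frontier_def interior_open)
    then show "c * ((1 - cmod z) * cmod (deriv h z)) \<le> dist (f z) w"
      using Koebe[OF that] by (simp add: dist_norm norm_minus_commute)
  qed
  define M where "M = max 1 (2 * C / (1 - a) / c)"
  have length: "curve_length (radial_arc f z) 0 t \<le> ennreal (M * infdist (radial_arc f z t) (frontier (f ` \<D>)))"
    if z: "z \<in> \<D>" and t: "t \<in> {0..1}" for z t
  proof -
    obtain \<zeta> where \<zeta>: "cmod \<zeta> = 1" "z = of_real (cmod z) * \<zeta>"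
      using polar by blast
    define \<rho> where "\<rho> = cmod z"
    have \<rho>: "0 \<le> \<rho>" "\<rho> < 1" using z by (auto simp: \<rho>_def)
    define r where "r = (1 - t) * \<rho>"
    have "r \<le> 1 * \<rho>" unfolding r_def using t \<rho> by (intro mult_right_mono) auto
    then have r: "0 \<le> r" "r < 1" using t \<rho> by (auto simp: r_def)
    have arc: "radial_arc f z x = f (of_real ((1 - x) * \<rho>) * \<zeta>)" for x
    proof -
      have "linepath z 0 x = of_real (1 - x) * z" by (simp add: linepath_def scaleR_conv_of_real)
      also have "\<dots> = of_real ((1 - x) * \<rho>) * \<zeta>" by (subst \<zeta>(2)) (simp add: \<rho>_def)
      finally show ?thesis by (simp add: radial_arc_def)
    qed
    have "curve_length (radial_arc f z) 0 t
        \<le> ennreal (- (B \<zeta> r * W ((1 - t) * \<rho>)) - - (B \<zeta> r * W ((1 - 0) * \<rho>)))"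
    proof (rule curve_length_le)
      fix x y assume xy: "0 \<le> x" "x \<le> y" "y \<le> t"
      have "dist (f (of_real ((1 - x) * \<rho>) * \<zeta>)) (f (of_real ((1 - y) * \<rho>) * \<zeta>))
          \<le> B \<zeta> r * W ((1 - x) * \<rho>) - B \<zeta> r * W ((1 - y) * \<rho>)"
      proof (rule dist[OF \<zeta>(1) r(1)])
        show "r \<le> (1 - y) * \<rho>" "(1 - y) * \<rho> \<le> (1 - x) * \<rho>"
          unfolding r_def using xy \<rho> by (auto intro!: mult_right_mono)
        have "(1 - x) * \<rho> \<le> 1 * \<rho>" using xy \<rho> by (intro mult_right_mono) auto
        then show "(1 - x) * \<rho> < 1" using \<rho> by simp
      qed
      then show "dist (radial_arc f z x) (radial_arc f z y)
          \<le> - (B \<zeta> r * W ((1 - y) * \<rho>)) - - (B \<zeta> r * W ((1 - x) * \<rho>))"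
        unfolding arc by linarith
    qed (use t in simp)
    also have "\<dots> \<le> ennreal (M * infdist (radial_arc f z t) (frontier (f ` \<D>)))"
    proof (rule ennreal_leI)
      have rz: "of_real r * \<zeta> \<in> \<D>" and cr: "cmod (of_real r * \<zeta>) = r"
        using r \<zeta>(1) by (auto simp: norm_mult)
      have "- (B \<zeta> r * W ((1 - t) * \<rho>)) - - (B \<zeta> r * W ((1 - 0) * \<rho>)) \<le> - (B \<zeta> r * W r)"
        using mult_nonneg_nonpos[OF B0 W] by (simp add: r_def)
      also have "\<dots> = 2 * C / (1 - a) / c * (c * ((1 - r) * cmod (deriv h (of_real r * \<zeta>))))"
        using c by (simp add: BW[OF r(2)])
      also have "\<dots> \<le> 2 * C / (1 - a) / c * infdist (f (of_real r * \<zeta>)) (frontier (f ` \<D>))"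
        using Koebe'[OF rz] a c C by (intro mult_left_mono) (simp_all only: cr, simp)
      also have "\<dots> \<le> M * infdist (f (of_real r * \<zeta>)) (frontier (f ` \<D>))"
        by (intro mult_right_mono) (auto simp: M_def infdist_nonneg)
      also have "f (of_real r * \<zeta>) = radial_arc f z t" by (simp only: arc r_def)
      finally show "- (B \<zeta> r * W ((1 - t) * \<rho>)) - - (B \<zeta> r * W ((1 - 0) * \<rho>))
          \<le> M * infdist (radial_arc f z t) (frontier (f ` \<D>))" .
    qed
    finally show ?thesis .
  qed
  have "rectifiable_path (radial_arc f z)" if z: "z \<in> \<D>" for z
    unfolding rectifiable_path_def
  proof
    have "closed_segment z 0 \<subseteq> \<D>" using z by (intro closed_segment_subset) auto
    then show "path (radial_arc f z)"
      unfolding radial_arc_def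
      by (intro path_continuous_image continuous_on_subset[OF contf]) auto
    have "curve_length (radial_arc f z) 0 1 \<le> ennreal (M * infdist (radial_arc f z 1) (frontier (f ` \<D>)))"
      using length[OF z, of 1] by simp
    then show "curve_length (radial_arc f z) 0 1 < \<infinity>"
      by (metis ennreal_less_top infinity_ennreal_def order_le_less_trans)
  qed
  then have "radial_c_John_disk M f (f ` \<D>)"
    unfolding radial_c_John_disk_def
    using inj openf bounded simply length by (auto simp: M_def)
  then show ?thesis unfolding radial_John_disk_def by blast
qed


section \<open>Dilatation and Pre-Schwarzian derivative\<close>

text \<open>For a harmonic map both sides of the distortion inequality are continuous, so its validity almost
  everywhere implies its validity everywhere; after division by \<open>|h'| + |g'|\<close> it is the bound
  \<open>(K - 1) / (K + 1)\<close> for the dilatation.\<close>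

lemma quasiconformal_dilatation_le:
  assumes rep: "harmonic_repr f h g" and J: "\<And>z. z \<in> \<D> \<Longrightarrow> 0 < jacobian f z"
    and qc: "quasiconformal_on K \<D> f" and K: "1 \<le> K" and z: "z \<in> \<D>"
  shows "cmod (deriv g z) \<le> (K - 1) / (K + 1) * cmod (deriv h z)"
proof -
  define u where "u = (\<lambda>z. (cmod (deriv h z) + cmod (deriv g z))\<^sup>2
    - K * ((cmod (deriv h z))\<^sup>2 - (cmod (deriv g z))\<^sup>2))"
  have "h holomorphic_on \<D>" "g holomorphic_on \<D>" using rep by (auto simp: harmonic_repr_def)
  then have "continuous_on \<D> (deriv h)" "continuous_on \<D> (deriv g)"
    by (auto intro!: holomorphic_on_imp_continuous_on holomorphic_deriv)
  then have "continuous_on \<D> u" unfolding u_def by (intro continuous_intros)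
  then have op: "open (\<D> \<inter> u -` {0<..})"
    by (intro continuous_open_preimage) auto
  have "AE z in lebesgue. z \<in> \<D> \<longrightarrow> u z \<le> 0"
  proof -
    have "AE z in lebesgue. z \<in> \<D> \<longrightarrow> (diff_norm f z)\<^sup>2 \<le> K * \<bar>jacobian f z\<bar>"
      using qc by (simp add: quasiconformal_on_def)
    then show ?thesis
    proof eventually_elim
      case (elim z)
      show ?case
      proof
        assume z: "z \<in> \<D>"
        then show "u z \<le> 0"
          using elim J[OF z] harmonic_repr_wirtinger[OF rep z] by (simp add: u_def diff_norm_def)
      qed
    qed
  qed
  then have "AE z in lebesgue. z \<notin> \<D> \<inter> u -` {0<..}"
    by eventually_elim auto
  then have "\<D> \<inter> u -` {0<..} \<in> null_sets lebesgue"
    using op by (subst AE_iff_null_sets) auto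
  then have "\<D> \<inter> u -` {0<..} = {}"
    using op open_not_negligible negligible_iff_null_sets by blast
  then have "u z \<le> 0" using z by force
  define p q where "p = cmod (deriv h z)" and "q = cmod (deriv g z)"
  have pq: "0 \<le> p" "0 \<le> q" "q\<^sup>2 < p\<^sup>2"
    using J[OF z] harmonic_repr_wirtinger(3)[OF rep z] by (auto simp: p_def q_def)
  then have "0 < p + q" by (metis add_nonneg_pos add_pos_nonneg less_eq_real_def less_irrefl)
  moreover have "(p + q) * (p + q) \<le> (p + q) * (K * (p - q))"
    using \<open>u z \<le> 0\<close> by (simp add: u_def p_def q_def power2_eq_square algebra_simps)
  ultimately have "p + q \<le> K * (p - q)" by simp
  then show ?thesis using K by (simp add: p_def q_def field_simps)
qed

text \<open>Over the common denominator \<open>h' J\<^sub>f\<close> the terms with \<open>g''\<close> cancel, and \<open>h''\<close> keeps the factor \<open>J\<^sub>f\<close>.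
  This is why part (b) is a condition on \<open>h\<close> alone.\<close>

lemma pre_schwarzian_add_dilatation:
  assumes rep: "harmonic_repr f h g" and z: "z \<in> \<D>" and J: "0 < jacobian f z"
  defines "\<omega> \<equiv> \<lambda>z. deriv g z / deriv h z"
  shows "pre_schwarzian f z + deriv \<omega> z * cnj (\<omega> z) / of_real (1 - (cmod (\<omega> z))\<^sup>2)
    = deriv (deriv h) z / deriv h z"
proof -
  define p q p' q' where "p = deriv h z" and "q = deriv g z"
    and "p' = deriv (deriv h) z" and "q' = deriv (deriv g) z"
  have "(cmod q)\<^sup>2 < (cmod p)\<^sup>2"
    using J harmonic_repr_wirtinger(3)[OF rep z] by (simp add: p_def q_def)
  then have p0: "p \<noteq> 0" by auto
  have nz: "p * cnj p - q * cnj q \<noteq> 0"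
    using \<open>(cmod q)\<^sup>2 < (cmod p)\<^sup>2\<close>
    by (simp only: complex_norm_square[symmetric] of_real_diff[symmetric] of_real_eq_0_iff)
  have "h holomorphic_on \<D>" "g holomorphic_on \<D>" using rep by (auto simp: harmonic_repr_def)
  then have "(deriv h has_field_derivative p') (at z)" "(deriv g has_field_derivative q') (at z)"
    unfolding p'_def q'_def using z
    by (auto intro!: holomorphic_derivI[of _ \<D>] holomorphic_deriv)
  from DERIV_divide[OF this(2,1)] p0
  have "deriv \<omega> z = (q' * p - q * p') / (p * p)"
    unfolding \<omega>_def p_def q_def by (intro DERIV_imp_deriv) simp
  moreover have "of_real (1 - (cmod (\<omega> z))\<^sup>2) = (p * cnj p - q * cnj q) / (p * cnj p)"
    using p0 unfolding \<omega>_def p_def[symmetric] q_def[symmetric]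
    by (simp add: of_real_diff complex_norm_square diff_divide_distrib del: of_real_power)
  moreover have "pre_schwarzian f z = (p' * cnj p - q' * cnj q) / (p * cnj p - q * cnj q)"
    unfolding pre_schwarzian_eq[OF rep z J] p_def q_def p'_def q'_def
    by (simp only: of_real_diff complex_norm_square)
  ultimately have "pre_schwarzian f z + deriv \<omega> z * cnj (\<omega> z) / of_real (1 - (cmod (\<omega> z))\<^sup>2)
      = (p' * cnj p - q' * cnj q) / (p * cnj p - q * cnj q)
        + (q' * p - q * p') / (p * p) * (cnj q / cnj p) / ((p * cnj p - q * cnj q) / (p * cnj p))"
    by (simp add: \<omega>_def p_def q_def)
  also have "\<dots> = ((p' * cnj p - q' * cnj q) * p + (q' * p - q * p') * cnj q) / (p * (p * cnj p - q * cnj q))"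
    using p0 nz by (simp add: divide_simps)
  also have "\<dots> = p' * (p * cnj p - q * cnj q) / (p * (p * cnj p - q * cnj q))"
    by (simp add: algebra_simps)
  also have "\<dots> = p' / p" using nz by simp
  finally show ?thesis by (simp add: p_def p'_def)
qed

lemma boundary_limsup_lessD:
  assumes "boundary_limsup u < ereal b"
  obtains r where "r < 1" "\<And>z. r < cmod z \<Longrightarrow> cmod z < 1 \<Longrightarrow> u z < b"
proof -
  have "eventually (\<lambda>z. ereal (u z) < ereal b) (filtercomap cmod (at_left 1))"
    using assms unfolding boundary_limsup_def by (rule Limsup_lessD)
  then obtain P where P: "eventually P (at_left (1::real))" "\<And>z. P (cmod z) \<Longrightarrow> u z < b"
    unfolding eventually_filtercomap by auto
  from P(1) obtain r where "r < 1" "\<And>y. r < y \<Longrightarrow> y < 1 \<Longrightarrow> P y"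
    unfolding eventually_at_left_field by auto
  with P(2) show thesis by (intro that) auto
qed


section \<open>The two criteria\<close>

theorem theorem1p5:
  fixes K k :: real and \<Omega> :: "complex set" and f h g \<omega> :: "complex \<Rightarrow> complex"
  assumes "1 \<le> K"
    and "open \<Omega>" and "connected \<Omega>"
    and "f \<in> S_H0_qc K \<Omega>"
    and "harmonic_repr f h g"
    and "\<omega> = (\<lambda>z. deriv g z / deriv h z)"
    and "k = (K - 1) / (K + 1)"
  shows
    "(k \<le> 1 / 2 \<longrightarrow>
      boundary_limsup (\<lambda>z. (1 - (cmod z)\<^sup>2) * Re (z * pre_schwarzian f z)) < ereal (1 + k) \<longrightarrow>
      radial_John_disk f \<Omega>) \<and>
     (inj_on h \<D> \<longrightarrow>
      boundary_limsup (\<lambda>z. (1 - (cmod z)\<^sup>2) *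
        cmod (pre_schwarzian f z
          + deriv \<omega> z * cnj (\<omega> z) / of_real (1 - (cmod (\<omega> z))\<^sup>2))) < 2 \<longrightarrow>
      radial_John_disk f \<Omega>)"
proof -
  note K = assms(1) and rep = assms(5) and \<omega> = assms(6) and k_def = assms(7)
  have inj: "inj_on f \<D>" and J: "\<And>z. z \<in> \<D> \<Longrightarrow> 0 < jacobian f z"
    and qc: "quasiconformal_on K \<D> f" and \<Omega>: "\<Omega> = f ` \<D>"
    using assms(4) by (auto simp: S_H0_qc_def S_H0_def S_H_def)
  have k: "0 \<le> k" "k < 1" using K by (auto simp: k_def)
  then have k2: "0 < 1 - k\<^sup>2" by (simp add: abs_square_less_1)
  have dil: "cmod (deriv g z) \<le> k * cmod (deriv h z)" if "z \<in> \<D>" for z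
    using quasiconformal_dilatation_le[OF rep J qc K that] by (simp add: k_def)
  have h: "h holomorphic_on \<D>" and g: "g holomorphic_on \<D>" using rep by (auto simp: harmonic_repr_def)
  have conth: "continuous_on \<D> (deriv h)"
    using h by (auto intro!: holomorphic_on_imp_continuous_on holomorphic_deriv)
  have J_eq: "jacobian f z = (cmod (deriv h z))\<^sup>2 - (cmod (deriv g z))\<^sup>2" if "z \<in> \<D>" for z
    using harmonic_repr_wirtinger(3)[OF rep that] .
  have h0: "deriv h z \<noteq> 0" if "z \<in> \<D>" for z
    using J[OF that] J_eq[OF that] by auto
  have dh: "(deriv h has_field_derivative deriv (deriv h) z) (at z)"
    and dg: "(deriv g has_field_derivative deriv (deriv g) z) (at z)" if "z \<in> \<D>" for z
    using h g that by (auto intro!: holomorphic_derivI[of _ \<D>] holomorphic_deriv)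
  \<comment> \<open>what both parts have in common: \<open>N\<close> is the Jacobian in (a) and \<open>|h'|\<^sup>2\<close> in (b)\<close>
  have John: "radial_John_disk f \<Omega>"
    if m: "0 < m" "\<And>z. z \<in> \<D> \<Longrightarrow> m * (cmod (deriv h z))\<^sup>2 \<le> N z" "\<And>z. z \<in> \<D> \<Longrightarrow> N z \<le> (cmod (deriv h z))\<^sup>2"
      and \<beta>: "0 \<le> \<beta>" "\<beta> < 2" "r0 < 1"
      and der: "\<And>z. r0 < cmod z \<Longrightarrow> cmod z < 1 \<Longrightarrow>
       \<exists>N'. (N has_derivative N') (at z) \<and> N' z \<le> 2 * \<beta> * N z / (1 - (cmod z)\<^sup>2)"
    for N :: "complex \<Rightarrow> real" and m \<beta> r0
  proof -
    obtain a C where "0 \<le> a" "a < 1" "0 < C"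
      "\<And>\<zeta> r \<rho>. cmod \<zeta> = 1 \<Longrightarrow> 0 \<le> r \<Longrightarrow> r \<le> \<rho> \<Longrightarrow> \<rho> < 1 \<Longrightarrow>
       cmod (deriv h (of_real \<rho> * \<zeta>)) * (1 - \<rho>) powr a \<le> C * (cmod (deriv h (of_real r * \<zeta>)) * (1 - r) powr a)"
      using radial_growth[OF conth h0 m \<beta> der] by blast
    from radial_John_disk_of_growth[OF rep inj k dil this] show ?thesis by (simp add: \<Omega>)
  qed
  show ?thesis
  proof (intro conjI impI)
    assume "boundary_limsup (\<lambda>z. (1 - (cmod z)\<^sup>2) * Re (z * pre_schwarzian f z)) < ereal (1 + k)"
    then obtain r0 where r0: "r0 < 1"
      "\<And>z. r0 < cmod z \<Longrightarrow> cmod z < 1 \<Longrightarrow> (1 - (cmod z)\<^sup>2) * Re (z * pre_schwarzian f z) < 1 + k"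
      by (rule boundary_limsup_lessD) (rule that)
    show "radial_John_disk f \<Omega>"
    proof (rule John[where N = "jacobian f" and m = "1 - k\<^sup>2" and \<beta> = "1 + k" and ?r0.0 = r0])
      fix z assume z: "z \<in> \<D>"
      show "(1 - k\<^sup>2) * (cmod (deriv h z))\<^sup>2 \<le> jacobian f z"
        using power_mono[OF dil[OF z], of 2] J_eq[OF z] by (simp add: power_mult_distrib algebra_simps)
      show "jacobian f z \<le> (cmod (deriv h z))\<^sup>2" using J_eq[OF z] by simp
    next
      fix z assume zr: "r0 < cmod z" "cmod z < 1"
      then have z: "z \<in> \<D>" by simp
      define A where "A = cnj (deriv h z) * deriv (deriv h) z - cnj (deriv g z) * deriv (deriv g) z"
      have "((\<lambda>z. (cmod (deriv h z))\<^sup>2 - (cmod (deriv g z))\<^sup>2) has_derivative (\<lambda>e. 2 * Re (A * e))) (at z)"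
        using has_derivative_diff[OF cmod2_has_derivative[OF dh[OF z]] cmod2_has_derivative[OF dg[OF z]]]
        by (simp add: A_def algebra_simps)
      then have dJ: "(jacobian f has_derivative (\<lambda>e. 2 * Re (A * e))) (at z)"
        by (rule has_derivative_transform_within_open[of _ _ _ _ \<D>]) (use J_eq z in auto)
      have nz: "complex_of_real ((cmod (deriv h z))\<^sup>2 - (cmod (deriv g z))\<^sup>2) \<noteq> 0"
        using J[OF z] J_eq[OF z] by (simp only: of_real_eq_0_iff)
      have "A = of_real (jacobian f z) * pre_schwarzian f z"
        unfolding pre_schwarzian_eq[OF rep z J[OF z]] J_eq[OF z] A_def
        by (subst times_divide_eq_right, subst nonzero_mult_div_cancel_left[OF nz]) (simp add: mult.commute)
      then have "2 * Re (A * z) = 2 * jacobian f z * Re (z * pre_schwarzian f z)"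
        by (simp add: algebra_simps)
      also have "\<dots> \<le> 2 * jacobian f z * ((1 + k) / (1 - (cmod z)\<^sup>2))"
      proof (rule mult_left_mono)
        have "0 < 1 - (cmod z)\<^sup>2" using zr by (simp add: abs_square_less_1)
        then show "Re (z * pre_schwarzian f z) \<le> (1 + k) / (1 - (cmod z)\<^sup>2)"
          using r0(2)[OF zr] by (simp add: pos_le_divide_eq mult.commute)
      qed (use J[OF z] in simp)
      finally show "\<exists>N'. (jacobian f has_derivative N') (at z) \<and>
          N' z \<le> 2 * (1 + k) * jacobian f z / (1 - (cmod z)\<^sup>2)"
        using dJ by (intro exI[of _ "\<lambda>e. 2 * Re (A * e)"]) (simp add: mult_ac)
    qed (use k k2 r0 in auto)
  next
    assume lim: "boundary_limsup (\<lambda>z. (1 - (cmod z)\<^sup>2) *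
        cmod (pre_schwarzian f z + deriv \<omega> z * cnj (\<omega> z) / of_real (1 - (cmod (\<omega> z))\<^sup>2))) < 2"
    then obtain b' where b': "boundary_limsup (\<lambda>z. (1 - (cmod z)\<^sup>2) *
        cmod (pre_schwarzian f z + deriv \<omega> z * cnj (\<omega> z) / of_real (1 - (cmod (\<omega> z))\<^sup>2))) < ereal b'" "ereal b' < 2"
      using ereal_dense2 by blast
    from b'(1) obtain r0 where r0: "r0 < 1"
      "\<And>z. r0 < cmod z \<Longrightarrow> cmod z < 1 \<Longrightarrow> (1 - (cmod z)\<^sup>2) *
        cmod (pre_schwarzian f z + deriv \<omega> z * cnj (\<omega> z) / of_real (1 - (cmod (\<omega> z))\<^sup>2)) < b'"
      by (rule boundary_limsup_lessD) (rule that)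
    have "b' < 2" using b'(2) by simp
    \<comment> \<open>the maximum with \<open>0\<close> because a number above the upper limit need not be nonnegative a priori\<close>
    show "radial_John_disk f \<Omega>"
    proof (rule John[where N = "\<lambda>z. (cmod (deriv h z))\<^sup>2" and m = 1 and \<beta> = "max b' 0" and ?r0.0 = r0])
      fix z assume zr: "r0 < cmod z" "cmod z < 1"
      then have z: "z \<in> \<D>" by simp
      define Q where "Q = deriv (deriv h) z / deriv h z"
      have pos: "0 < 1 - (cmod z)\<^sup>2" using zr by (simp add: abs_square_less_1)
      have "(1 - (cmod z)\<^sup>2) * cmod Q < b'"
        using r0(2)[OF zr] pre_schwarzian_add_dilatation[OF rep z J[OF z]] by (simp add: \<omega> Q_def)
      then have Q: "cmod Q \<le> max b' 0 / (1 - (cmod z)\<^sup>2)"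
        using pos by (simp add: pos_le_divide_eq mult.commute)
      have "cnj (deriv h z) * deriv (deriv h) z * z = (cmod (deriv h z))\<^sup>2 *\<^sub>R (Q * z)"
        unfolding scaleR_conv_of_real complex_norm_square Q_def using h0[OF z] by simp
      then have "2 * Re (cnj (deriv h z) * deriv (deriv h) z * z) = 2 * (cmod (deriv h z))\<^sup>2 * Re (Q * z)"
        by (simp only: scaleR_complex.sel mult.assoc)
      also have "\<dots> \<le> 2 * (cmod (deriv h z))\<^sup>2 * (max b' 0 / (1 - (cmod z)\<^sup>2))"
      proof (rule mult_left_mono)
        have "Re (Q * z) \<le> cmod Q * cmod z" using complex_Re_le_cmod[of "Q * z"] by (simp add: norm_mult)
        also have "\<dots> \<le> cmod Q * 1" using zr by (intro mult_left_mono) auto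
        finally show "Re (Q * z) \<le> max b' 0 / (1 - (cmod z)\<^sup>2)" using Q by simp
      qed simp
      finally show "\<exists>N'. ((\<lambda>z. (cmod (deriv h z))\<^sup>2) has_derivative N') (at z) \<and>
          N' z \<le> 2 * max b' 0 * (cmod (deriv h z))\<^sup>2 / (1 - (cmod z)\<^sup>2)"
        using cmod2_has_derivative[OF dh[OF z]]
        by (intro exI[of _ "\<lambda>e. 2 * Re (cnj (deriv h z) * deriv (deriv h) z * e)"]) (simp add: mult_ac)
    qed (use \<open>b' < 2\<close> r0 in auto)
  qed
qed

end
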